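(* Let $T>0$, $I=(0,1)$, let $G\subset[0,T]\times I$ be measurable, and let $G_{\mathrm{ref}}=\{(t,s)\in[0,T]\times\mathbb T_2:(t,\pi(s))\in G\}$, where $\mathbb T_2=\mathbb R/(2\mathbb Z)$ and $\pi(s)=s$ for $0\le s\le1$, $\pi(s)=2-s$ for $1<s<2$. Then: (i) $G$ satisfies (GCC) on the interval if and only if $G_{\mathrm{ref}}$ satisfies (GCC) on $\mathbb T_2$; (ii) (OBS-T) holds on $G_{\mathrm{ref}}$ if and only if both (OBS-D) and (OBS-N) hold on $G$.
   Context: Characteristics on the interval. For $x\in I$, extending $\pi$ $2$-periodically to $\mathbb R$, put $L_{[x;\xi]}(s)=(s,\pi(x+s))$ and $L_{[x;\eta]}(s)=(s,\pi(x-s))$ for $s\ge0$ (unit-speed lines starting from $(0,x)$ to the right, resp. left, reflected at $x=0,1$). (GCC) on the interval. There is $c_0>0$ such that for almost every $x\in[0,1]$ both $\mathcal H^1(G\cap\{L_{[x;\eta]}(s):s\in[0,T]\})\ge c_0$ and $\mathcal H^1(G\cap\{L_{[x;\xi]}(s):s\in[0,T]\})\ge c_0$ ($\mathcal H^1$ is one-dimensional Hausdorff measure). (GCC) on $\mathbb T_2$. A measurable $H\subset[0,T]\times\mathbb T_2$ satisfies (GCC) if there is $c_0>0$ such that for almost every $x\in\mathbb T_2$ both $\mathcal H^1(H\cap\{(s,x+s):s\in[0,T]\})\ge c_0$ and $\mathcal H^1(H\cap\{(s,x-s):s\in[0,T]\})\ge c_0$. (OBS-D) on $G$: there is $C>0$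 such that every weak solution $u\in C([0,T];H_0^1(I))\cap C^1([0,T];L^2(I))$ of $\partial_t^2u-\partial_x^2u=0$ on $[0,T]\times I$, $u(t,0)=u(t,1)=0$, $(u,\partial_tu)|_{t=0}=(u_0,u_1)\in H_0^1(I)\times L^2(I)$ satisfies $\|\partial_xu_0\|_{L^2(I)}^2+\|u_1\|_{L^2(I)}^2\le C\iint_G|\partial_tu|^2\,dx\,dt$. (OBS-N) on $G$: there is $C>0$ such that every weak solution $u\in C([0,T];H^1(I))\cap C^1([0,T];L^2(I))$ of $\partial_t^2u-\partial_x^2u=0$ on $[0,T]\times I$, $\partial_xu(t,0)=\partial_xu(t,1)=0$, $(u,\partial_tu)|_{t=0}=(u_0,u_1)\in H^1(I)\times L^2(I)$ satisfies $\|\partial_xu_0\|_{L^2(I)}^2+\|u_1\|_{L^2(I)}^2\le C\iint_G|\partial_tu|^2\,dx\,dt$. (OBS-T) on a measurable $H\subset[0,T]\times\mathbb T_2$: there is $C>0$ such that every weak solution $v$ of $\partial_t^2v-\partial_x^2v=0$ on $[0,T]\times\mathbb T_2$, $(v,\partial_tv)|_{t=0}=(v_0,v_1)\in H^1(\mathbb T_2)\times L^2(\mathbb T_2)$ satisfies $\|\partial_xv_0\|_{L^2(\mathbb T_2)}^2+\|v_1\|_{L^2(\mathbb T_2)}^2\le C\iint_H|\partial_tv|^2\,dx\,dt$. *)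

theory Defs
  imports "HOL-Analysis.Analysis" "HOL-Library.Real_Mod"
begin

section \<open>One-dimensional Hausdorff measure\<close>

definition ediam :: "('a \<Rightarrow> 'a \<Rightarrow> real) \<Rightarrow> 'a set \<Rightarrow> ennreal" where
  "ediam d E = (SUP p\<in>E. SUP q\<in>E. ennreal (d p q))"

text \<open>The distance is a parameter because the same measure is needed for the Euclidean distance
  on the plane and for the flat distance on a cylinder.  As an outer measure it is defined on all
  sets, so that no measurability of individual slices has to be assumed.\<close>

definition hausdorff1 :: "('a \<Rightarrow> 'a \<Rightarrow> real) \<Rightarrow> 'a set \<Rightarrow> ennreal" where
  "hausdorff1 d S =
     (SUP \<delta>\<in>{0<..}. INF E\<in>{E :: nat \<Rightarrow> 'a set. S \<subseteq> (\<Union>n. E n) \<and> (\<forall>n. ediam d (E n) \<le> ennreal \<delta>)}.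
        \<Sum>n. ediam d (E n))"


section \<open>The interval, the torus and the folding map\<close>

abbreviation unit_ival :: "real set" where
  "unit_ival \<equiv> {0<..<1}"

text \<open>The torus of length 2 is modelled by its fundamental domain; the class of a real number
  \<open>y\<close> is represented by \<open>y rmod 2\<close>.  Periodic structure enters through the quotient distance,
  through translations modulo 2, and through the 2-periodic test functions below.\<close>

abbreviation torus2 :: "real set" where
  "torus2 \<equiv> {0..<2}"

definition torus2_dist :: "real \<Rightarrow> real \<Rightarrow> real" where
  "torus2_dist x y = (INF k::int. \<bar>x - y + 2 * of_int k\<bar>)"

definition cyl_dist :: "real \<times> real \<Rightarrow> real \<times> real \<Rightarrow> real" where
  "cyl_dist p q = sqrt ((fst p - fst q)\<^sup>2 + (torus2_dist (snd p) (snd q))\<^sup>2)"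

definition fold2 :: "real \<Rightarrow> real" where
  "fold2 s = (if s rmod 2 \<le> 1 then s rmod 2 else 2 - s rmod 2)"

definition G_ref :: "real \<Rightarrow> (real \<times> real) set \<Rightarrow> (real \<times> real) set" where
  "G_ref T G = {(t, s). t \<in> {0..T} \<and> s \<in> torus2 \<and> (t, fold2 s) \<in> G}"


section \<open>Geometric control conditions\<close>

definition GCC_interval :: "real \<Rightarrow> (real \<times> real) set \<Rightarrow> bool" where
  "GCC_interval T G \<longleftrightarrow> (\<exists>c\<^sub>0::real. c\<^sub>0 > 0 \<and> (AE x\<in>{0..1} in lebesgue.
      hausdorff1 dist (G \<inter> {(s, fold2 (x - s)) | s. s \<in> {0..T}}) \<ge> ennreal c\<^sub>0 \<and>
      hausdorff1 dist (G \<inter> {(s, fold2 (x + s)) | s. s \<in> {0..T}}) \<ge> ennreal c\<^sub>0))"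

definition GCC_torus :: "real \<Rightarrow> (real \<times> real) set \<Rightarrow> bool" where
  "GCC_torus T H \<longleftrightarrow> (\<exists>c\<^sub>0::real. c\<^sub>0 > 0 \<and> (AE x\<in>torus2 in lebesgue.
      hausdorff1 cyl_dist (H \<inter> {(s, (x + s) rmod 2) | s. s \<in> {0..T}}) \<ge> ennreal c\<^sub>0 \<and>
      hausdorff1 cyl_dist (H \<inter> {(s, (x - s) rmod 2) | s. s \<in> {0..T}}) \<ge> ennreal c\<^sub>0))"


section \<open>Square-integrable functions and Sobolev spaces\<close>

definition L2 :: "real set \<Rightarrow> (real \<Rightarrow> real) set" where
  "L2 J = {f. f \<in> borel_measurable (lebesgue_on J) \<and> integrable (lebesgue_on J) (\<lambda>x. (f x)\<^sup>2)}"

definition L2_inner :: "real set \<Rightarrow> (real \<Rightarrow> real) \<Rightarrow> (real \<Rightarrow> real) \<Rightarrow> real" where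
  "L2_inner J f g = (LINT x|lebesgue_on J. f x * g x)"

definition L2_norm :: "real set \<Rightarrow> (real \<Rightarrow> real) \<Rightarrow> real" where
  "L2_norm J f = sqrt (L2_inner J f f)"

text \<open>Test functions: \<open>C\<^sup>1\<close> functions with compact support in a bounded open interval
  (closedness of the support suffices there), and \<open>C\<^sup>1\<close> functions on the torus.\<close>

definition C1c :: "real set \<Rightarrow> (real \<Rightarrow> real) set" where
  "C1c J = {\<phi>. \<phi> C1_differentiable_on UNIV \<and> closure {x. \<phi> x \<noteq> 0} \<subseteq> J}"

definition C1_torus :: "(real \<Rightarrow> real) set" where
  "C1_torus = {\<phi>. \<phi> C1_differentiable_on UNIV \<and> (\<forall>x. \<phi> (x + 2) = \<phi> x)}"

text \<open>\<open>g\<close> is a weak derivative of \<open>f\<close> on \<open>J\<close>, tested against \<open>\<Phi>\<close>; both square integrable.\<close>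

definition weak_deriv :: "real set \<Rightarrow> (real \<Rightarrow> real) set \<Rightarrow> (real \<Rightarrow> real) \<Rightarrow> (real \<Rightarrow> real) \<Rightarrow> bool" where
  "weak_deriv J \<Phi> f g \<longleftrightarrow> f \<in> L2 J \<and> g \<in> L2 J \<and>
     (\<forall>\<phi>\<in>\<Phi>. L2_inner J f (deriv \<phi>) = - L2_inner J g \<phi>)"

text \<open>Sobolev spaces are given as sets of pairs \<open>(f, f')\<close> of a function and (a version of) its
  weak derivative.  \<open>H\<^sup>1\<^sub>0\<close> is the closure of the compactly supported test functions in \<open>H\<^sup>1\<close>.\<close>

type_synonym sobolev = "((real \<Rightarrow> real) \<times> (real \<Rightarrow> real)) set"

definition H1 :: sobolev where
  "H1 = {(f, f'). weak_deriv unit_ival (C1c unit_ival) f f'}"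

definition H10 :: sobolev where
  "H10 = {(f, f'). (f, f') \<in> H1 \<and> (\<forall>\<epsilon>>0. \<exists>\<phi>\<in>C1c unit_ival.
     sqrt ((L2_norm unit_ival (\<lambda>x. \<phi> x - f x))\<^sup>2 + (L2_norm unit_ival (\<lambda>x. deriv \<phi> x - f' x))\<^sup>2) < \<epsilon>)}"

definition H1_torus :: sobolev where
  "H1_torus = {(f, f'). weak_deriv torus2 C1_torus f f'}"


section \<open>Weak solutions of the wave equation\<close>

definition L2_continuous :: "real \<Rightarrow> real set \<Rightarrow> (real \<Rightarrow> real \<Rightarrow> real) \<Rightarrow> bool" where
  "L2_continuous T J w \<longleftrightarrow> (\<forall>t\<in>{0..T}. w t \<in> L2 J \<and>
     ((\<lambda>s. L2_norm J (\<lambda>x. w s x - w t x)) \<longlongrightarrow> 0) (at t within {0..T}))"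

definition L2_has_time_deriv ::
    "real \<Rightarrow> real set \<Rightarrow> (real \<Rightarrow> real \<Rightarrow> real) \<Rightarrow> (real \<Rightarrow> real \<Rightarrow> real) \<Rightarrow> bool" where
  "L2_has_time_deriv T J u w \<longleftrightarrow> (\<forall>t\<in>{0..T}.
     ((\<lambda>s. L2_norm J (\<lambda>x. (u s x - u t x) / (s - t) - w t x)) \<longlongrightarrow> 0) (at t within {0..T}))"

text \<open>\<open>u \<in> C([0,T];V) \<inter> C\<^sup>1([0,T];L\<^sup>2(J))\<close>, with space derivative \<open>ux\<close> and time derivative \<open>ut\<close>,
  solves \<open>d/dt (\<partial>\<^sub>t u, \<psi>) + (\<partial>\<^sub>x u, \<partial>\<^sub>x \<psi>) = 0\<close> weakly on \<open>(0,T)\<close> for every \<open>\<psi> \<in> V\<close>.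
  The boundary condition is carried by \<open>V\<close>: Dirichlet for \<open>V = H\<^sup>1\<^sub>0\<close>, and (as natural boundary
  condition) Neumann for \<open>V = H\<^sup>1\<close>; for \<open>V = H\<^sup>1\<close> of the torus there is none.
  Continuity into \<open>V\<close> is continuity of \<open>u\<close> and \<open>ux\<close> into \<open>L\<^sup>2\<close>.
  Each \<open>ut t\<close> is only determined almost everywhere; joint measurability selects, as is always
  possible for a continuous curve in \<open>L\<^sup>2\<close>, representatives for which space-time integrals
  make sense.\<close>

definition weak_wave_sol ::
    "real \<Rightarrow> real set \<Rightarrow> sobolev \<Rightarrow> (real \<Rightarrow> real \<Rightarrow> real) \<Rightarrow> (real \<Rightarrow> real \<Rightarrow> real) \<Rightarrow> (real \<Rightarrow> real \<Rightarrow> real) \<Rightarrow> bool"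
  where
  "weak_wave_sol T J V u ux ut \<longleftrightarrow>
     (\<forall>t\<in>{0..T}. (u t, ux t) \<in> V) \<and>
     L2_continuous T J u \<and> L2_continuous T J ux \<and>
     L2_continuous T J ut \<and> L2_has_time_deriv T J u ut \<and>
     (\<lambda>(t, x). ut t x) \<in> borel_measurable (lebesgue_on ({0..T} \<times> J)) \<and>
     (\<forall>(\<psi>, \<psi>x)\<in>V. weak_deriv {0<..<T} (C1c {0<..<T})
        (\<lambda>t. L2_inner J (ut t) \<psi>) (\<lambda>t. - L2_inner J (ux t) \<psi>x))"


section \<open>Observability\<close>

text \<open>The initial data of \<open>u\<close> are \<open>(u 0, ut 0)\<close>.\<close>

definition observable :: "real \<Rightarrow> real set \<Rightarrow> sobolev \<Rightarrow> (real \<times> real) set \<Rightarrow> bool" where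
  "observable T J V G \<longleftrightarrow> (\<exists>C::real. C > 0 \<and> (\<forall>u ux ut. weak_wave_sol T J V u ux ut \<longrightarrow>
     ennreal ((L2_norm J (ux 0))\<^sup>2 + (L2_norm J (ut 0))\<^sup>2)
       \<le> ennreal C * (\<integral>\<^sup>+(t, x)\<in>G. ennreal (\<bar>ut t x\<bar>\<^sup>2) \<partial>lebesgue)))"

definition OBS_D :: "real \<Rightarrow> (real \<times> real) set \<Rightarrow> bool" where
  "OBS_D T G \<longleftrightarrow> observable T unit_ival H10 G"

definition OBS_N :: "real \<Rightarrow> (real \<times> real) set \<Rightarrow> bool" where
  "OBS_N T G \<longleftrightarrow> observable T unit_ival H1 G"

definition OBS_T :: "real \<Rightarrow> (real \<times> real) set \<Rightarrow> bool" where
  "OBS_T T H \<longleftrightarrow> observable T torus2 H1_torus H"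

end

(* Reflection. Extending a Dirichlet (Neumann) solution on (0,1) oddly (evenly) across x = 1 gives a
   solution on the torus of length 2, and conversely the odd and even parts of a torus solution,
   restricted to (0,1), are a Dirichlet and a Neumann solution whose energies and observed integrals
   add up. Extension and folding are adjoint to each other in L2, which transfers both membership in
   the Sobolev spaces and the weak formulation. The one analytic point is that the odd part of an
   H1 function on the torus lies in the closure of the test functions: its derivative has mean zero,
   hence is approximated by derivatives of test functions, and the error of the functions themselves
   is controlled by duality. For (i), the fold maps a line of the torus onto the reflected line,
   bi-Lipschitz with constants 1 and sqrt 2. *)

theory Submission
  imports Defs
begin

section \<open>Geometric control and the folding map\<close>

text \<open>\<open>H10\<close> is a closure and Sobolev functions are arbitrary representatives, so
  boundary values are never evaluated: they are encoded in the test functions that integration by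
  parts admits. Folding a periodic C1 function with \<open>refl_sum (-1)\<close> gives a function
  that vanishes at 0 and 1 without having compact support; folding with \<open>refl_sum 1\<close>
  leaves its values there free. The compactly supported tests must therefore be enlarged:
  \<open>H1\<close> has to accept C1 functions vanishing at both ends, \<open>H10\<close> all C1
  functions. Conversely, the odd fold of a torus function can be tested against functions that do
  not vanish at 1, and this forces it into the closure.

  Differentiation in space reverses parity, so the sign \<open>s\<close> for a function always comes
  with \<open>- s\<close> for its derivative; \<open>s = 1\<close> is the Neumann case and
  \<open>s = -1\<close> the Dirichlet case. The fold is not divided by 2: in this form it is the
  exact adjoint of \<open>refl_ext s\<close>, and the factors 2 appear in the energy and in the
  observed integral alike.\<close>

lemma ediam_ge: "p \<in> E \<Longrightarrow> q \<in> E \<Longrightarrow> ennreal (d p q) \<le> ediam d E"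
  unfolding ediam_def by (rule SUP_upper2[of p], simp, rule SUP_upper)

lemma ediam_image_le:
  assumes "L > 0" "\<And>p q. p \<in> E \<Longrightarrow> q \<in> E \<Longrightarrow> d' (F p) (F q) \<le> L * d p q"
  shows "ediam d' (F ` E) \<le> ennreal L * ediam d E"
  unfolding ediam_def[of d'] image_image
proof (intro SUP_least)
  fix p q assume "p \<in> E" "q \<in> E"
  then have "ennreal (d' (F p) (F q)) \<le> ennreal L * ennreal (d p q)"
    using assms by (simp add: ennreal_mult'[symmetric] ennreal_leI)
  also have "\<dots> \<le> ennreal L * ediam d E"
    using \<open>p \<in> E\<close> \<open>q \<in> E\<close> by (intro mult_left_mono ediam_ge) auto
  finally show "ennreal (d' (F p) (F q)) \<le> ennreal L * ediam d E" .
qed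

text \<open>A cover of \<open>S\<close> of mesh \<open>\<delta> / L\<close> is pushed forward to a
  cover of the image of mesh \<open>\<delta>\<close>. Each piece is first cut down to
  \<open>S\<close>, because \<open>F\<close> is controlled only there.\<close>

lemma hausdorff1_lipschitz_image:
  assumes L: "L > 0" and lip: "\<And>p q. p \<in> S \<Longrightarrow> q \<in> S \<Longrightarrow> d' (F p) (F q) \<le> L * d p q"
  shows "hausdorff1 d' ((F :: 'a \<Rightarrow> 'b) ` S) \<le> ennreal L * hausdorff1 d S"
  unfolding hausdorff1_def[of d']
proof (rule SUP_least)
  fix \<delta> :: real assume "\<delta> \<in> {0<..}"
  then have \<delta>: "\<delta> > 0" by simp
  let ?X = "INF E'\<in>{E' :: nat \<Rightarrow> 'b set. F ` S \<subseteq> (\<Union>n. E' n) \<and> (\<forall>n. ediam d' (E' n) \<le> ennreal \<delta>)}.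
        \<Sum>n. ediam d' (E' n)"
  let ?C = "{E :: nat \<Rightarrow> 'a set. S \<subseteq> (\<Union>n. E n) \<and> (\<forall>n. ediam d (E n) \<le> ennreal (\<delta> / L))}"
  \<comment> \<open>The factor \<open>L\<close> goes to the left as a divisor, so that the bound can
    be checked for one cover at a time below the infimum.\<close>
  have "?X / ennreal L \<le> (INF E\<in>?C. \<Sum>n. ediam d (E n))"
  proof (rule INF_greatest)
    fix E assume E: "E \<in> ?C"
    have le: "ediam d' (F ` (E n \<inter> S)) \<le> ennreal L * ediam d (E n)" for n
    proof -
      have "ediam d' (F ` (E n \<inter> S)) \<le> ennreal L * ediam d (E n \<inter> S)"
        by (rule ediam_image_le) (use L lip in auto)
      also have "\<dots> \<le> ennreal L * ediam d (E n)"
        unfolding ediam_def by (intro mult_left_mono SUP_subset_mono) auto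
      finally show ?thesis .
    qed
    have "ediam d' (F ` (E n \<inter> S)) \<le> ennreal \<delta>" for n
    proof -
      have "ennreal L * ediam d (E n) \<le> ennreal L * ennreal (\<delta> / L)"
        using E by (intro mult_left_mono) auto
      also have "\<dots> = ennreal \<delta>" using L \<delta> by (simp add: ennreal_mult[symmetric])
      finally show ?thesis using le[of n] by order
    qed
    moreover have "F ` S \<subseteq> (\<Union>n. F ` (E n \<inter> S))" using E by blast
    ultimately have "?X \<le> (\<Sum>n. ediam d' (F ` (E n \<inter> S)))"
      by (intro INF_lower) auto
    also have "\<dots> \<le> (\<Sum>n. ennreal L * ediam d (E n))" by (intro suminf_le le) auto
    also have "\<dots> = (\<Sum>n. ediam d (E n)) * ennreal L" by (simp add: mult.commute)
    finally show "?X / ennreal L \<le> (\<Sum>n. ediam d (E n))"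
      using L by (intro divide_le_posI_ennreal) (auto simp: mult.commute)
  qed
  also have "\<dots> \<le> hausdorff1 d S"
    unfolding hausdorff1_def using L \<delta> by (intro SUP_upper) auto
  finally have "ennreal L * (?X / ennreal L) \<le> ennreal L * hausdorff1 d S"
    by (intro mult_left_mono) auto
  moreover have "ennreal L * (?X / ennreal L) = ?X"
    using L by (simp add: ennreal_times_divide mult.commute[of "ennreal L"] ennreal_mult_divide_eq)
  ultimately show "?X \<le> ennreal L * hausdorff1 d S" by simp
qed

section \<open>The fold as the distance to the even integers\<close>

lemma rmod2_eq: "\<exists>k::int. x rmod 2 = x + 2 * of_int k"
  unfolding rmod_def by (rule exI[of _ "- \<lfloor>x / 2\<rfloor>"]) simp

text \<open>\<open>fold2 x\<close> is the distance from \<open>x\<close> to the even integers; this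
  bound and \<open>fold2_attained\<close> together say so. Symmetry and the Lipschitz bound are
  derived from that description.\<close>

lemma fold2_le: "fold2 x \<le> \<bar>x + 2 * of_int k\<bar>"
proof -
  obtain j :: int where j: "x rmod 2 = x + 2 * of_int j" using rmod2_eq by blast
  have r: "0 \<le> x rmod 2" "x rmod 2 < 2" by (simp_all add: rmod_nonneg rmod_less)
  have x: "x + 2 * of_int k = x rmod 2 + 2 * of_int (k - j)" using j by simp
  consider "k - j \<ge> 0" | "k - j \<le> -1" by linarith
  then show ?thesis
  proof cases
    case 1
    then have "(of_int (k - j) :: real) \<ge> 0" by simp
    then show ?thesis using r x unfolding fold2_def by auto
  next
    case 2
    then have "(of_int (k - j) :: real) \<le> of_int (-1)" using of_int_le_iff by blast
    then show ?thesis using r x unfolding fold2_def by auto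
  qed
qed

lemma fold2_attained: "\<exists>k::int. fold2 x = \<bar>x + 2 * of_int k\<bar>"
proof -
  obtain j :: int where j: "x rmod 2 = x + 2 * of_int j" using rmod2_eq by blast
  have r: "0 \<le> x rmod 2" "x rmod 2 < 2" by (simp_all add: rmod_nonneg rmod_less)
  show ?thesis
  proof (cases "x rmod 2 \<le> 1")
    case True
    then show ?thesis using j r by (intro exI[of _ j]) (simp add: fold2_def)
  next
    case False
    \<comment> \<open>For \<open>x rmod 2\<close> beyond 1 the nearest even integer is the next one
      to the right, hence \<open>j - 1\<close>.\<close>
    then show ?thesis using j r by (intro exI[of _ "j - 1"]) (simp add: fold2_def)
  qed
qed

text \<open>A distance to a set is 1-Lipschitz, and the shift by \<open>2 * k\<close> preserves the
  even integers. Taking the infimum over \<open>k\<close> turns the right-hand side into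
  \<open>torus2_dist\<close>.\<close>

lemma fold2_diff_le: "\<bar>fold2 x - fold2 y\<bar> \<le> \<bar>x - y + 2 * of_int k\<bar>"
proof -
  have le: "fold2 x \<le> fold2 y + \<bar>x - y + 2 * of_int k\<bar>" for x y k
  proof -
    obtain j :: int where j: "fold2 y = \<bar>y + 2 * of_int j\<bar>" using fold2_attained by blast
    have "fold2 x \<le> \<bar>x + 2 * of_int (j + k)\<bar>" by (rule fold2_le)
    also have "x + 2 * of_int (j + k) = (y + 2 * of_int j) + (x - y + 2 * of_int k)" by simp
    also have "\<bar>\<dots>\<bar> \<le> \<bar>y + 2 * of_int j\<bar> + \<bar>x - y + 2 * of_int k\<bar>"
      by (rule abs_triangle_ineq)
    finally show ?thesis by (simp only: j)
  qed
  have "\<bar>y - x + 2 * of_int (- k)\<bar> = \<bar>x - y + 2 * of_int k\<bar>" by simp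
  with le[of x y k] le[of y x "- k"] show ?thesis by linarith
qed

lemma fold2_uminus: "fold2 (- x) = fold2 x"
proof -
  have "fold2 (- y) \<le> fold2 y" for y
  proof -
    obtain i :: int where i: "fold2 y = \<bar>y + 2 * of_int i\<bar>" using fold2_attained by blast
    show ?thesis using fold2_le[of "- y" "- i"] i by simp
  qed
  from this[of x] this[of "- x"] show ?thesis by simp
qed

lemma fold2_rmod: "fold2 (x rmod 2) = fold2 x"
  by (simp add: fold2_def)

lemma fold2_minus2: "fold2 (2 - x) = fold2 x"
  using fold2_diff_le[of "2 - x" "- x" "-1"] by (simp add: fold2_uminus)

lemma torus2_dist_le: "torus2_dist x y \<le> \<bar>x - y + 2 * of_int k\<bar>"
  unfolding torus2_dist_def by (rule cINF_lower) (auto intro!: bdd_belowI[of _ 0])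

lemma torus2_dist_nonneg: "torus2_dist x y \<ge> 0"
  unfolding torus2_dist_def by (rule cINF_greatest) auto

lemma fold2_lipschitz: "\<bar>fold2 x - fold2 y\<bar> \<le> torus2_dist x y"
  unfolding torus2_dist_def by (rule cINF_greatest) (auto intro: fold2_diff_le)

lemma torus2_dist_rmod_le: "torus2_dist (x rmod 2) (y rmod 2) \<le> \<bar>x - y\<bar>"
proof -
  obtain i :: int where i: "x rmod 2 = x + 2 * of_int i" using rmod2_eq by blast
  obtain j :: int where j: "y rmod 2 = y + 2 * of_int j" using rmod2_eq by blast
  show ?thesis using torus2_dist_le[of "x rmod 2" "y rmod 2" "j - i"] i j by simp
qed

text \<open>Folding is 1-Lipschitz and maps the torus line injectively onto the reflected line; the
  inverse is \<open>sqrt 2\<close>-Lipschitz because both points are determined by their time coordinate.\<close>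

lemma hausdorff1_fold_line:
  fixes T :: real and G :: "(real \<times> real) set" and l :: "real \<Rightarrow> real"
  assumes l: "\<And>s s'. \<bar>l s - l s'\<bar> \<le> \<bar>s - s'\<bar>"
  defines "A \<equiv> G_ref T G \<inter> {(s, l s rmod 2) | s. s \<in> {0..T}}"
    and "B \<equiv> G \<inter> {(s, fold2 (l s)) | s. s \<in> {0..T}}"
  shows "hausdorff1 dist B \<le> hausdorff1 cyl_dist A"
    and "hausdorff1 cyl_dist A \<le> ennreal (sqrt 2) * hausdorff1 dist B"
proof -
  have A: "A = {(s, l s rmod 2) | s. s \<in> {0..T} \<and> (s, fold2 (l s)) \<in> G}"
    unfolding A_def G_ref_def by (auto simp: fold2_rmod rmod_nonneg rmod_less)
  have B: "B = {(s, fold2 (l s)) | s. s \<in> {0..T} \<and> (s, fold2 (l s)) \<in> G}"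
    unfolding B_def by auto
  have lift: "A = (\<lambda>p. (fst p, l (fst p) rmod 2)) ` B"
    unfolding A B by force
  have proj: "B = (\<lambda>p. (fst p, fold2 (snd p))) ` A"
    unfolding A B by (force simp: fold2_rmod)
  have "dist (fst p, fold2 (snd p)) (fst q, fold2 (snd q)) \<le> 1 * cyl_dist p q" for p q
    unfolding cyl_dist_def dist_Pair_Pair dist_real_def
    using fold2_lipschitz[of "snd p" "snd q"]
    by (auto intro!: real_sqrt_le_mono add_mono abs_le_square_iff[THEN iffD1]
        simp: torus2_dist_nonneg)
  then have "hausdorff1 dist ((\<lambda>p. (fst p, fold2 (snd p))) ` A) \<le> ennreal 1 * hausdorff1 cyl_dist A"
    by (intro hausdorff1_lipschitz_image) simp_all
  then show "hausdorff1 dist B \<le> hausdorff1 cyl_dist A" by (simp flip: proj)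
  have "cyl_dist (fst p, l (fst p) rmod 2) (fst q, l (fst q) rmod 2) \<le> sqrt 2 * dist p q" for p q :: "real \<times> real"
  proof -
    \<comment> \<open>At speed at most 1 the squared space increment is at most the squared time
      increment; adding the two gives the factor 2 under the root.\<close>
    have "torus2_dist (l (fst p) rmod 2) (l (fst q) rmod 2) \<le> \<bar>fst p - fst q\<bar>"
      using torus2_dist_rmod_le l by (meson order_trans)
    then have "(torus2_dist (l (fst p) rmod 2) (l (fst q) rmod 2))\<^sup>2 \<le> (fst p - fst q)\<^sup>2"
      by (intro abs_le_square_iff[THEN iffD1]) (simp add: torus2_dist_nonneg)
    then have "cyl_dist (fst p, l (fst p) rmod 2) (fst q, l (fst q) rmod 2) \<le> sqrt (2 * (fst p - fst q)\<^sup>2)"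
      unfolding cyl_dist_def by (auto intro!: real_sqrt_le_mono)
    also have "\<dots> = sqrt 2 * dist (fst p) (fst q)" by (simp add: real_sqrt_mult dist_real_def)
    also have "\<dots> \<le> sqrt 2 * dist p q" by (intro mult_left_mono dist_fst_le) auto
    finally show ?thesis .
  qed
  then have "hausdorff1 cyl_dist ((\<lambda>p. (fst p, l (fst p) rmod 2)) ` B) \<le> ennreal (sqrt 2) * hausdorff1 dist B"
    by (intro hausdorff1_lipschitz_image) simp_all
  then show "hausdorff1 cyl_dist A \<le> ennreal (sqrt 2) * hausdorff1 dist B"
    by (simp flip: lift)
qed

text \<open>A smooth map sends null sets to null sets. The interval condition speaks only of
  starting points in \<open>{0..1}\<close>, and the reflection supplies the remaining half of the
  torus.\<close>

lemma AE_lebesgue_reflect: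
  assumes "AE x in lebesgue. P x"
  shows "AE x in lebesgue. P (2 - x :: real)"
proof -
  obtain N where N: "{x. \<not> P x} \<subseteq> N" "negligible N"
    using assms by (auto elim!: AE_E simp: negligible_iff_null_sets null_sets_def)
  have "negligible ((\<lambda>x. 2 - x) ` N)"
    by (rule negligible_differentiable_image_negligible)
      (auto intro!: N derivative_intros simp: differentiable_on_def)
  moreover have "{x. \<not> P (2 - x)} \<subseteq> (\<lambda>x. 2 - x) ` N"
  proof
    fix x assume "x \<in> {x. \<not> P (2 - x)}"
    then have "2 - x \<in> N" using N by auto
    then show "x \<in> (\<lambda>x. 2 - x) ` N" by (intro image_eqI[of _ _ "2 - x"]) auto
  qed
  ultimately show ?thesis
    by (auto simp: eventually_ae_filter negligible_iff_null_sets)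
qed

lemma GCC_interval_iff_torus: "GCC_interval T G \<longleftrightarrow> GCC_torus T (G_ref T G)"
proof
  let ?Am = "\<lambda>x. hausdorff1 dist (G \<inter> {(s, fold2 (x - s)) | s. s \<in> {0..T}})"
  let ?Ap = "\<lambda>x. hausdorff1 dist (G \<inter> {(s, fold2 (x + s)) | s. s \<in> {0..T}})"
  let ?Bm = "\<lambda>x. hausdorff1 cyl_dist (G_ref T G \<inter> {(s, (x - s) rmod 2) | s. s \<in> {0..T}})"
  let ?Bp = "\<lambda>x. hausdorff1 cyl_dist (G_ref T G \<inter> {(s, (x + s) rmod 2) | s. s \<in> {0..T}})"
  have m: "?Am x \<le> ?Bm x" "?Bm x \<le> ennreal (sqrt 2) * ?Am x" for x
    by (rule hausdorff1_fold_line[of "\<lambda>s. x - s"]; simp)+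
  have p: "?Ap x \<le> ?Bp x" "?Bp x \<le> ennreal (sqrt 2) * ?Ap x" for x
    by (rule hausdorff1_fold_line[of "\<lambda>s. x + s"]; simp)+
  {
    assume "GCC_interval T G"
    then obtain c where c: "c > 0"
      "AE x in lebesgue. x \<in> {0..1} \<longrightarrow> ?Am x \<ge> ennreal c \<and> ?Ap x \<ge> ennreal c"
      unfolding GCC_interval_def by auto
    \<comment> \<open>Starting from \<open>2 - x\<close> and moving left folds to the same curve as
      starting from \<open>x\<close> and moving right. Points beyond 1 are thus covered with the two
      families of lines exchanged.\<close>
    have "?Am (2 - x) = ?Ap x" "?Ap (2 - x) = ?Am x" for x
      using fold2_minus2[of "x + s" for s] fold2_minus2[of "x - s" for s]
      by (simp_all add: algebra_simps)
    with AE_lebesgue_reflect[OF c(2)]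
    have "AE x in lebesgue. 2 - x \<in> {0..1} \<longrightarrow> ?Ap x \<ge> ennreal c \<and> ?Am x \<ge> ennreal c" by simp
    with c(2) have "AE x in lebesgue. x \<in> torus2 \<longrightarrow> ?Bp x \<ge> ennreal c \<and> ?Bm x \<ge> ennreal c"
    proof eventually_elim
      case (elim x)
      then show ?case using m(1)[of x] p(1)[of x]
        by (cases "x \<le> 1") auto
    qed
    with c(1) show "GCC_torus T (G_ref T G)" unfolding GCC_torus_def by auto
  }
  {
    assume "GCC_torus T (G_ref T G)"
    then obtain c where c: "c > 0"
      "AE x in lebesgue. x \<in> torus2 \<longrightarrow> ?Bp x \<ge> ennreal c \<and> ?Bm x \<ge> ennreal c"
      unfolding GCC_torus_def by auto
    \<comment> \<open>The lift is \<open>sqrt 2\<close>-Lipschitz, so the constant on the interval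
      drops to \<open>c / sqrt 2\<close>; in the other direction it is unchanged.\<close>
    have div: "ennreal (c / sqrt 2) \<le> y" if "ennreal c \<le> ennreal (sqrt 2) * y" for y
    proof -
      have "ennreal c / ennreal (sqrt 2) \<le> y"
        using that by (intro divide_le_posI_ennreal) (auto simp: mult.commute)
      then show ?thesis using c(1) by (simp add: divide_ennreal)
    qed
    from c(2) have "AE x in lebesgue. x \<in> {0..1} \<longrightarrow> ?Am x \<ge> ennreal (c / sqrt 2) \<and> ?Ap x \<ge> ennreal (c / sqrt 2)"
    proof eventually_elim
      case (elim x)
      then show ?case using m(2)[of x] p(2)[of x] by (intro impI conjI div) auto
    qed
    with c(1) show "GCC_interval T G" unfolding GCC_interval_def
      by (intro exI[of _ "c / sqrt 2"]) auto
  }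
qed

section \<open>Square-integrable functions and reflection\<close>

lemma L2_measurable: "f \<in> L2 J \<Longrightarrow> f \<in> borel_measurable (lebesgue_on J)"
  by (simp add: L2_def)

lemma L2_mult_integrable:
  assumes "f \<in> L2 J" "g \<in> L2 J"
  shows "integrable (lebesgue_on J) (\<lambda>x. f x * g x)"
proof (rule Bochner_Integration.integrable_bound)
  show "integrable (lebesgue_on J) (\<lambda>x. (f x)\<^sup>2 + (g x)\<^sup>2)"
    using assms by (simp add: L2_def)
  show "(\<lambda>x. f x * g x) \<in> borel_measurable (lebesgue_on J)"
    using assms by (intro borel_measurable_times) (simp_all add: L2_def)
  have "\<bar>a * b\<bar> \<le> a\<^sup>2 + b\<^sup>2" for a b :: real
  proof -
    have "2 * \<bar>a * b\<bar> \<le> a\<^sup>2 + b\<^sup>2"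
      using sum_squares_bound[of "\<bar>a\<bar>" "\<bar>b\<bar>"] by (simp add: abs_mult mult.assoc)
    then show ?thesis using abs_ge_zero[of "a * b"] by linarith
  qed
  then show "AE x in lebesgue_on J. norm (f x * g x) \<le> norm ((f x)\<^sup>2 + (g x)\<^sup>2)"
    by auto
qed

lemma L2_add:
  assumes "f \<in> L2 J" "g \<in> L2 J"
  shows "(\<lambda>x. f x + g x) \<in> L2 J"
proof -
  have "integrable (lebesgue_on J) (\<lambda>x. (f x)\<^sup>2 + (g x)\<^sup>2 + 2 * (f x * g x))"
    using assms L2_mult_integrable[OF assms] by (simp add: L2_def)
  moreover have "(\<lambda>x. f x + g x) \<in> borel_measurable (lebesgue_on J)"
    using assms by (intro borel_measurable_add) (simp_all add: L2_def)
  ultimately show ?thesis by (simp add: L2_def power2_sum mult.assoc)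
qed

lemma L2_scale: "f \<in> L2 J \<Longrightarrow> (\<lambda>x. c * f x) \<in> L2 J"
  unfolding L2_def by (auto simp: power_mult_distrib intro!: borel_measurable_times)

lemma L2_diff: "f \<in> L2 J \<Longrightarrow> g \<in> L2 J \<Longrightarrow> (\<lambda>x. f x - g x) \<in> L2 J"
  using L2_add[of f J "\<lambda>x. (-1) * g x"] L2_scale[of g J "-1"] by simp

lemma L2_cong:
  assumes "\<And>x. x \<in> J \<Longrightarrow> f x = g x"
  shows "f \<in> L2 J \<longleftrightarrow> g \<in> L2 J"
proof -
  have "f \<in> borel_measurable (lebesgue_on J) \<longleftrightarrow> g \<in> borel_measurable (lebesgue_on J)"
    using assms by (intro measurable_cong) simp
  moreover have "integrable (lebesgue_on J) (\<lambda>x. (f x)\<^sup>2) \<longleftrightarrow> integrable (lebesgue_on J) (\<lambda>x. (g x)\<^sup>2)"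
    using assms by (intro Bochner_Integration.integrable_cong) simp_all
  ultimately show ?thesis by (simp add: L2_def)
qed

lemma L2_inner_cong:
  assumes "\<And>x. x \<in> J \<Longrightarrow> f x = f' x" "\<And>x. x \<in> J \<Longrightarrow> g x = g' x"
  shows "L2_inner J f g = L2_inner J f' g'"
  unfolding L2_inner_def using assms by (intro Bochner_Integration.integral_cong) simp_all

lemma L2_norm_cong: "(\<And>x. x \<in> J \<Longrightarrow> f x = g x) \<Longrightarrow> L2_norm J f = L2_norm J g"
  unfolding L2_norm_def by (simp cong: L2_inner_cong)

lemma L2_inner_add_left:
  "f \<in> L2 J \<Longrightarrow> g \<in> L2 J \<Longrightarrow> h \<in> L2 J \<Longrightarrow> L2_inner J (\<lambda>x. f x + g x) h = L2_inner J f h + L2_inner J g h"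
  unfolding L2_inner_def using L2_mult_integrable by (simp add: distrib_right)

lemma L2_inner_scale_left: "L2_inner J (\<lambda>x. c * f x) h = c * L2_inner J f h"
  unfolding L2_inner_def by (simp add: mult.assoc)

lemma L2_inner_commute: "L2_inner J f g = L2_inner J g f"
  unfolding L2_inner_def by (simp add: mult.commute)

lemma L2_inner_add_right:
  "f \<in> L2 J \<Longrightarrow> g \<in> L2 J \<Longrightarrow> h \<in> L2 J \<Longrightarrow> L2_inner J h (\<lambda>x. f x + g x) = L2_inner J h f + L2_inner J h g"
  using L2_inner_add_left[of f J g h] by (simp add: L2_inner_commute)

lemma L2_inner_scale_right: "L2_inner J h (\<lambda>x. c * f x) = c * L2_inner J h f"
  using L2_inner_scale_left[of J c f h] by (simp add: L2_inner_commute)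

lemma L2_inner_diff_left:
  "f \<in> L2 J \<Longrightarrow> g \<in> L2 J \<Longrightarrow> h \<in> L2 J \<Longrightarrow> L2_inner J (\<lambda>x. f x - g x) h = L2_inner J f h - L2_inner J g h"
  unfolding L2_inner_def using L2_mult_integrable by (simp add: left_diff_distrib)

lemma L2_inner_diff_right:
  "f \<in> L2 J \<Longrightarrow> g \<in> L2 J \<Longrightarrow> h \<in> L2 J \<Longrightarrow> L2_inner J h (\<lambda>x. f x - g x) = L2_inner J h f - L2_inner J h g"
  using L2_inner_diff_left[of f J g h] by (simp add: L2_inner_commute)

lemma L2_inner_self_nonneg: "L2_inner J f f \<ge> 0"
  unfolding L2_inner_def by (intro integral_nonneg_AE) auto

lemma L2_norm_nonneg [simp]: "L2_norm J f \<ge> 0"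
  by (simp add: L2_norm_def L2_inner_self_nonneg)

lemma L2_norm_power2: "(L2_norm J f)\<^sup>2 = L2_inner J f f"
  by (simp add: L2_norm_def L2_inner_self_nonneg)

lemma L2_norm_scale: "L2_norm J (\<lambda>x. c * f x) = \<bar>c\<bar> * L2_norm J f"
  by (simp add: L2_norm_def L2_inner_scale_left L2_inner_scale_right real_sqrt_mult flip: mult.assoc)

lemma L2_norm_power2_add:
  assumes "f \<in> L2 J" "g \<in> L2 J"
  shows "(L2_norm J (\<lambda>x. f x + g x))\<^sup>2 = (L2_norm J f)\<^sup>2 + 2 * L2_inner J f g + (L2_norm J g)\<^sup>2"
  using assms
  by (simp add: L2_norm_power2 L2_inner_add_left L2_inner_add_right L2_add L2_inner_commute[of J g f])

text \<open>The quadratic in \<open>t\<close> given by the squared norm of \<open>f + t * g\<close>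
  is nonnegative and is evaluated at its minimiser. \<open>L2_norm\<close> is only a seminorm on
  functions, so norm zero of \<open>g\<close> is a separate case: there the quadratic is affine in
  \<open>t\<close>, and a nonnegative affine function has slope zero.\<close>

lemma L2_Cauchy_Schwarz:
  assumes f: "f \<in> L2 J" and g: "g \<in> L2 J"
  shows "\<bar>L2_inner J f g\<bar> \<le> L2_norm J f * L2_norm J g"
proof -
  let ?A = "L2_norm J f" and ?B = "L2_inner J f g" and ?C = "L2_norm J g"
  have quad: "0 \<le> ?A\<^sup>2 + 2 * (t * ?B) + t\<^sup>2 * ?C\<^sup>2" for t
    using L2_norm_power2_add[OF f L2_scale[OF g, of t]]
    by (simp add: L2_norm_scale L2_inner_scale_right power_mult_distrib)
      (metis zero_le_power2)
  have "?B\<^sup>2 \<le> (?A * ?C)\<^sup>2"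
  proof (cases "?C = 0")
    case True
    have "?B = 0"
    proof (rule ccontr)
      assume "?B \<noteq> 0"
      then have "- (?A\<^sup>2 + 1) / ?B * ?B = - (?A\<^sup>2 + 1)" by simp
      with quad[of "- (?A\<^sup>2 + 1) / ?B"] True have "?A\<^sup>2 + 2 \<le> 0" by simp
      then show False using zero_le_power2[of ?A] by linarith
    qed
    then show ?thesis by simp
  next
    case False
    then have C: "?C\<^sup>2 > 0" by simp
    have "0 \<le> ?A\<^sup>2 - ?B\<^sup>2 / ?C\<^sup>2"
      using quad[of "- ?B / ?C\<^sup>2"] False by (simp add: power2_eq_square)
    then show ?thesis using C by (simp add: pos_divide_le_eq power_mult_distrib)
  qed
  then have "\<bar>?B\<bar> \<le> \<bar>?A * ?C\<bar>" by (simp only: abs_le_square_iff)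
  then show ?thesis by simp
qed

lemma L2_norm_triangle:
  assumes "f \<in> L2 J" "g \<in> L2 J"
  shows "L2_norm J (\<lambda>x. f x + g x) \<le> L2_norm J f + L2_norm J g"
proof (rule power2_le_imp_le)
  show "(L2_norm J (\<lambda>x. f x + g x))\<^sup>2 \<le> (L2_norm J f + L2_norm J g)\<^sup>2"
    using L2_Cauchy_Schwarz[OF assms] L2_norm_power2_add[OF assms] by (simp add: power2_sum)
qed simp

text \<open>Twice the even (\<open>s = 1\<close>) or odd (\<open>s = -1\<close>) part about 1.
  Modulo 2 the points \<open>2 - x\<close> and \<open>- x\<close> agree, so parity about 1 is also
  parity about 0.\<close>

definition refl_sum :: "real \<Rightarrow> (real \<Rightarrow> real) \<Rightarrow> real \<Rightarrow> real" where
  "refl_sum s f x = f x + s * f (2 - x)"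

text \<open>The value 0 at the seams 0 and 1 and outside the period affects a null set of the torus
  only, and makes the extension linear at every point.\<close>

definition refl_ext :: "real \<Rightarrow> (real \<Rightarrow> real) \<Rightarrow> real \<Rightarrow> real" where
  "refl_ext s f x = (if x \<in> {0<..<1} then f x else if x \<in> {1<..<2} then s * f (2 - x) else 0)"

section \<open>Splitting the torus at 1 and reflecting its second half\<close>

lemma distr_lebesgue_reflect: "distr lebesgue lebesgue (\<lambda>x::real. 2 - x) = lebesgue"
  using lebesgue_real_affine[of "-1" 2] by (simp add: density_1 flip: one_ennreal_def)

lemma lebesgue_reflect_measurable [measurable]: "(\<lambda>x::real. 2 - x) \<in> lebesgue \<rightarrow>\<^sub>M lebesgue"
  using lebesgue_affine_measurable[of "\<lambda>_. -1::real" "2::real"] by simp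

text \<open>The torus is cut at 1 and \<open>{1<..<2}\<close> is carried to the unit interval by the
  measure-preserving map \<open>2 - x\<close>; the seams 0 and 1 form a null set.\<close>

lemma integrable_torus2D:
  fixes f :: "real \<Rightarrow> real"
  assumes "integrable (lebesgue_on torus2) f"
  shows "integrable (lebesgue_on unit_ival) f"
    and "integrable (lebesgue_on unit_ival) (\<lambda>x. f (2 - x))"
    and "(LINT x|lebesgue_on torus2. f x) = (LINT x|lebesgue_on unit_ival. f x + f (2 - x))"
proof -
  have F: "integrable lebesgue (\<lambda>x. indicator torus2 x * f x)"
    using assms by (simp add: integrable_restrict_space)
  have sub: "integrable lebesgue (\<lambda>x. indicator A x * f x)" if "A \<in> sets lebesgue" "A \<subseteq> torus2" for A
  proof -
    have "(\<lambda>x. indicator A x *\<^sub>R (indicator torus2 x * f x)) = (\<lambda>x. indicator A x * f x)"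
    proof
      fix x show "indicator A x *\<^sub>R (indicator torus2 x * f x) = indicator A x * f x"
        using that(2) by (cases "x \<in> A") auto
    qed
    with integrable_mult_indicator[OF that(1) F] show ?thesis by simp
  qed
  have 1: "integrable lebesgue (\<lambda>x. indicator unit_ival x * f x)"
    and 2: "integrable lebesgue (\<lambda>x. indicator {1<..<2} x * f x)"
    by (rule sub; auto)+
  have R: "indicator {1<..<2} (2 - x) * f (2 - x) = indicator unit_ival x * f (2 - x)" for x :: real
    by (auto simp: indicator_def)
  have 3: "integrable lebesgue (\<lambda>x. indicator unit_ival x * f (2 - x))"
    using 2 integrable_distr_eq[OF lebesgue_reflect_measurable, of "\<lambda>x. indicator {1<..<2} x * f x"]
    by (simp add: distr_lebesgue_reflect R borel_measurable_integrable)
  show "integrable (lebesgue_on unit_ival) f" using 1 by (simp add: integrable_restrict_space)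
  show "integrable (lebesgue_on unit_ival) (\<lambda>x. f (2 - x))" using 3 by (simp add: integrable_restrict_space)
  have ae: "AE x in lebesgue. indicator torus2 x * f x = indicator unit_ival x * f x + indicator {1<..<2} x * f x"
  proof -
    have "AE x in lebesgue. x \<notin> {0, 1::real}"
      by (rule AE_not_in) (simp add: negligible_iff_null_sets[symmetric])
    then show ?thesis by eventually_elim (auto simp: indicator_def)
  qed
  have "(LINT x|lebesgue_on torus2. f x) = (LINT x|lebesgue. indicator torus2 x * f x)"
    by (simp add: integral_restrict_space)
  also have "\<dots> = (LINT x|lebesgue. indicator unit_ival x * f x + indicator {1<..<2} x * f x)"
    by (rule integral_cong_AE) (use F 1 2 ae in \<open>auto simp: borel_measurable_integrable\<close>)
  also have "\<dots> = (LINT x|lebesgue. indicator unit_ival x * f x) + (LINT x|lebesgue. indicator {1<..<2} x * f x)"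
    using 1 2 by (rule Bochner_Integration.integral_add)
  also have "(LINT x|lebesgue. indicator {1<..<2} x * f x) = (LINT x|lebesgue. indicator unit_ival x * f (2 - x))"
    using 2 integral_distr[OF lebesgue_reflect_measurable, of "\<lambda>x. indicator {1<..<2} x * f x"]
    by (simp add: distr_lebesgue_reflect R borel_measurable_integrable)
  also have "(LINT x|lebesgue. indicator unit_ival x * f x) + (LINT x|lebesgue. indicator unit_ival x * f (2 - x))
     = (LINT x|lebesgue. indicator unit_ival x * (f x + f (2 - x)))"
    using 1 3 by (simp add: distrib_left)
  also have "\<dots> = (LINT x|lebesgue_on unit_ival. f x + f (2 - x))"
    by (simp add: integral_restrict_space)
  finally show "(LINT x|lebesgue_on torus2. f x) = (LINT x|lebesgue_on unit_ival. f x + f (2 - x))" .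
qed

lemma measurable_torus2D:
  fixes f :: "real \<Rightarrow> real"
  assumes "f \<in> borel_measurable (lebesgue_on torus2)"
  shows "f \<in> borel_measurable (lebesgue_on unit_ival)"
    and "(\<lambda>x. f (2 - x)) \<in> borel_measurable (lebesgue_on unit_ival)"
proof -
  have F: "(\<lambda>x. indicator torus2 x * f x) \<in> borel_measurable lebesgue"
    using assms by (simp add: borel_measurable_restrict_space_iff)
  have "(\<lambda>x. indicator unit_ival x * (indicator torus2 x * f x)) \<in> borel_measurable lebesgue"
    by (intro borel_measurable_times borel_measurable_indicator F) simp
  also have "(\<lambda>x. indicator unit_ival x * (indicator torus2 x * f x)) = (\<lambda>x. indicator unit_ival x * f x)"
    by (auto simp: indicator_def)
  finally show "f \<in> borel_measurable (lebesgue_on unit_ival)"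
    by (simp add: borel_measurable_restrict_space_iff)
  have "(\<lambda>x. indicator unit_ival x * (indicator torus2 (2 - x) * f (2 - x))) \<in> borel_measurable lebesgue"
    by (intro borel_measurable_times borel_measurable_indicator
        measurable_compose[OF lebesgue_reflect_measurable F]) simp
  also have "(\<lambda>x. indicator unit_ival x * (indicator torus2 (2 - x) * f (2 - x))) = (\<lambda>x. indicator unit_ival x * f (2 - x))"
    by (auto simp: indicator_def)
  finally show "(\<lambda>x. f (2 - x)) \<in> borel_measurable (lebesgue_on unit_ival)"
    by (simp add: borel_measurable_restrict_space_iff)
qed

text \<open>Replaces the case distinction by two indicator terms, valid at every point.
  Measurability and integrability of the extension then reduce to composition with the
  reflection.\<close>

lemma refl_ext_eq:
  "indicator torus2 x * refl_ext s f x
     = indicator unit_ival x * f x + s * (indicator unit_ival (2 - x) * f (2 - x))"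
  by (auto simp: refl_ext_def indicator_def)

lemma integrable_refl_ext:
  assumes "integrable (lebesgue_on unit_ival) f"
  shows "integrable (lebesgue_on torus2) (refl_ext s f)"
proof -
  have F: "integrable lebesgue (\<lambda>x. indicator unit_ival x * f x)"
    using assms by (simp add: integrable_restrict_space)
  then have "integrable lebesgue (\<lambda>x. indicator unit_ival (2 - x) * f (2 - x))"
    using integrable_distr_eq[OF lebesgue_reflect_measurable, of "\<lambda>x. indicator unit_ival x * f x"]
    by (simp add: distr_lebesgue_reflect borel_measurable_integrable)
  with F show ?thesis by (simp add: integrable_restrict_space refl_ext_eq)
qed

lemma measurable_refl_ext:
  assumes "f \<in> borel_measurable (lebesgue_on unit_ival)"
  shows "refl_ext s f \<in> borel_measurable (lebesgue_on torus2)"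
proof -
  have F: "(\<lambda>x. indicator unit_ival x * f x) \<in> borel_measurable lebesgue"
    using assms by (simp add: borel_measurable_restrict_space_iff)
  from measurable_compose[OF lebesgue_reflect_measurable this]
  show ?thesis using F by (simp add: borel_measurable_restrict_space_iff refl_ext_eq)
qed

lemma L2_torus2D:
  assumes "f \<in> L2 torus2"
  shows "f \<in> L2 unit_ival" and "(\<lambda>x. f (2 - x)) \<in> L2 unit_ival"
  using assms by (auto simp: L2_def intro: measurable_torus2D integrable_torus2D)

lemma refl_sum_L2: "f \<in> L2 torus2 \<Longrightarrow> refl_sum s f \<in> L2 unit_ival"
  unfolding refl_sum_def[abs_def] by (intro L2_add L2_scale L2_torus2D)

lemma refl_ext_L2:
  assumes "f \<in> L2 unit_ival"
  shows "refl_ext s f \<in> L2 torus2"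
proof -
  have "(\<lambda>x. (refl_ext s f x)\<^sup>2) = refl_ext (s\<^sup>2) (\<lambda>x. (f x)\<^sup>2)"
    by (auto simp: refl_ext_def power_mult_distrib)
  then show ?thesis
    using assms by (simp add: L2_def measurable_refl_ext integrable_refl_ext)
qed

lemma L2_inner_torus2:
  assumes "f \<in> L2 torus2" "g \<in> L2 torus2"
  shows "L2_inner torus2 f g
    = L2_inner unit_ival f g + L2_inner unit_ival (\<lambda>x. f (2 - x)) (\<lambda>x. g (2 - x))"
  using integrable_torus2D[OF L2_mult_integrable[OF assms]] by (simp add: L2_inner_def)

text \<open>On the second half, reflected back, the extension is \<open>s * f\<close>, and the
  scalar \<open>s\<close> moves over to \<open>g\<close>.\<close>

lemma L2_inner_refl_ext:
  assumes "f \<in> L2 unit_ival" "g \<in> L2 torus2"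
  shows "L2_inner torus2 (refl_ext s f) g = L2_inner unit_ival f (refl_sum s g)"
proof -
  have "L2_inner torus2 (refl_ext s f) g
      = L2_inner unit_ival (refl_ext s f) g + L2_inner unit_ival (\<lambda>x. refl_ext s f (2 - x)) (\<lambda>x. g (2 - x))"
    by (intro L2_inner_torus2 refl_ext_L2 assms)
  also have "\<dots> = L2_inner unit_ival f g + L2_inner unit_ival (\<lambda>x. s * f x) (\<lambda>x. g (2 - x))"
    by (intro arg_cong2[of _ _ _ _ "(+)"] L2_inner_cong) (auto simp: refl_ext_def)
  also have "\<dots> = L2_inner unit_ival f (refl_sum s g)"
    unfolding refl_sum_def[abs_def] using assms L2_torus2D[OF assms(2)]
    by (simp add: L2_inner_add_right L2_scale L2_inner_scale_left L2_inner_scale_right)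
  finally show ?thesis .
qed

lemma L2_norm_refl_ext:
  assumes "f \<in> L2 unit_ival" "\<bar>s\<bar> = 1"
  shows "(L2_norm torus2 (refl_ext s f))\<^sup>2 = 2 * (L2_norm unit_ival f)\<^sup>2"
proof -
  have s: "s * s = 1" using assms(2) by (metis abs_mult_self_eq mult_1)
  have "(L2_norm torus2 (refl_ext s f))\<^sup>2 = L2_inner unit_ival f (refl_sum s (refl_ext s f))"
    using assms by (simp add: L2_norm_power2 L2_inner_refl_ext refl_ext_L2)
  also have "\<dots> = L2_inner unit_ival f (\<lambda>x. 2 * f x)"
    \<comment> \<open>Folding the extension returns \<open>f\<close> multiplied by
      \<open>1 + s * s = 2\<close>.\<close>
    by (intro L2_inner_cong) (auto simp: refl_sum_def refl_ext_def s simp flip: mult.assoc)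
  finally show ?thesis by (simp add: L2_norm_power2 L2_inner_scale_right)
qed

text \<open>The parallelogram law for \<open>f\<close> and its reflection: the cross terms of the
  two signs cancel, and the two halves together make up the torus norm.\<close>

lemma L2_norm_refl_sum:
  assumes "f \<in> L2 torus2"
  shows "(L2_norm unit_ival (refl_sum 1 f))\<^sup>2 + (L2_norm unit_ival (refl_sum (-1) f))\<^sup>2
    = 2 * (L2_norm torus2 f)\<^sup>2"
proof -
  note f = L2_torus2D[OF assms]
  have "refl_sum (-1) f = (\<lambda>x. f x + (-1) * f (2 - x))" "refl_sum 1 f = (\<lambda>x. f x + f (2 - x))"
    by (auto simp: refl_sum_def)
  then show ?thesis
    using L2_norm_power2_add[OF f] L2_norm_power2_add[OF f(1) L2_scale[OF f(2), of "-1"]]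
      L2_inner_torus2[OF assms assms] L2_norm_scale[of unit_ival "-1" "\<lambda>x. f (2 - x)"]
      L2_inner_scale_right[of unit_ival f "-1" "\<lambda>x. f (2 - x)"]
    by (simp flip: L2_norm_power2)
qed

section \<open>Test functions\<close>

lemma C1_UNIV_has_deriv:
  fixes f :: "real \<Rightarrow> real"
  assumes "f C1_differentiable_on UNIV"
  shows "(f has_real_derivative deriv f x) (at x)"
    and "continuous_on UNIV (deriv f)" and "continuous_on UNIV f"
proof -
  obtain D where D: "\<And>x. (f has_vector_derivative D x) (at x)" "continuous_on UNIV D"
    using assms by (auto simp: C1_differentiable_on_def)
  then have D': "(f has_real_derivative D x) (at x)" for x
    by (simp add: has_real_derivative_iff_has_vector_derivative)
  then have "deriv f = D" by (auto intro: DERIV_imp_deriv)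
  then show "(f has_real_derivative deriv f x) (at x)" "continuous_on UNIV (deriv f)"
    using D D' by simp_all
  show "continuous_on UNIV f"
    using D' by (meson DERIV_continuous continuous_at_imp_continuous_on)
qed

lemma C1_UNIV_I:
  fixes f :: "real \<Rightarrow> real"
  assumes "\<And>x. (f has_real_derivative D x) (at x)" "continuous_on UNIV D"
  shows "f C1_differentiable_on UNIV" and "deriv f = D"
  using assms by (auto simp: C1_differentiable_on_def has_real_derivative_iff_has_vector_derivative[symmetric]
      intro: DERIV_imp_deriv)

lemma continuous_imp_integrable_subset:
  fixes f :: "real \<Rightarrow> real"
  assumes "continuous_on UNIV f" "A \<in> sets lebesgue" "A \<subseteq> {a..b}"
  shows "integrable (lebesgue_on A) f"
proof -
  have "integrable (lebesgue_on {a..b}) f"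
    using assms(1) by (intro continuous_imp_integrable_real) (auto intro: continuous_on_subset)
  then have F: "integrable lebesgue (\<lambda>x. indicator {a..b} x * f x)"
    by (simp add: integrable_restrict_space)
  have "(\<lambda>x. indicator A x *\<^sub>R (indicator {a..b} x * f x)) = (\<lambda>x. indicator A x * f x)"
  proof
    fix x show "indicator A x *\<^sub>R (indicator {a..b} x * f x) = indicator A x * f x"
      using assms(3) by (cases "x \<in> A") auto
  qed
  with integrable_mult_indicator[OF assms(2) F] show ?thesis
    using assms(2) by (simp add: integrable_restrict_space)
qed

lemma continuous_imp_L2:
  fixes f :: "real \<Rightarrow> real"
  assumes "continuous_on UNIV f" "A \<in> sets lebesgue" "A \<subseteq> {a..b}"
  shows "f \<in> L2 A"
  unfolding L2_def
  using continuous_imp_integrable_subset[OF assms]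
    continuous_imp_integrable_subset[OF continuous_on_power[OF assms(1)] assms(2,3)]
  by (simp add: borel_measurable_integrable)

lemma continuous_imp_L2_unit: "continuous_on UNIV f \<Longrightarrow> f \<in> L2 unit_ival"
  by (rule continuous_imp_L2[where a = 0 and b = 1]) auto

lemma continuous_imp_L2_torus2: "continuous_on UNIV f \<Longrightarrow> f \<in> L2 torus2"
  by (rule continuous_imp_L2[where a = 0 and b = 2]) auto

section \<open>Integration by parts and Poincare's inequality on the unit interval\<close>

lemma LINT_deriv_unit:
  assumes "\<And>x. (f has_real_derivative D x) (at x)" "continuous_on UNIV D"
  shows "(LINT x|lebesgue_on unit_ival. D x) = f 1 - f 0"
proof -
  have "integrable (lebesgue_on unit_ival) D"
    using assms(2) by (rule continuous_imp_integrable_subset[where a = 0 and b = 1]) auto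
  then have "(LINT x|lebesgue_on unit_ival. D x) = integral unit_ival D"
    by (simp add: lebesgue_integral_eq_integral)
  moreover have "(D has_integral f 1 - f 0) {0..1}"
    by (rule fundamental_theorem_of_calculus)
      (auto intro!: has_field_derivative_at_within assms(1) simp flip: has_real_derivative_iff_has_vector_derivative)
  ultimately show ?thesis
    by (simp add: integral_unique integral_open_interval_real[symmetric])
qed

lemma L2_inner_by_parts_C1:
  assumes "f C1_differentiable_on UNIV" "g C1_differentiable_on UNIV" "f 0 * g 0 = f 1 * g 1"
  shows "L2_inner unit_ival f (deriv g) = - L2_inner unit_ival (deriv f) g"
proof -
  note f = C1_UNIV_has_deriv[OF assms(1)] and g = C1_UNIV_has_deriv[OF assms(2)]
  have "(LINT x|lebesgue_on unit_ival. f x * deriv g x + deriv f x * g x) = f 1 * g 1 - f 0 * g 0"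
    by (rule LINT_deriv_unit) (auto intro!: derivative_eq_intros f g continuous_intros)
  moreover have "integrable (lebesgue_on unit_ival) (\<lambda>x. f x * deriv g x)"
    "integrable (lebesgue_on unit_ival) (\<lambda>x. deriv f x * g x)"
    using f g by (auto intro!: L2_mult_integrable continuous_imp_L2_unit)
  ultimately show ?thesis using assms(3) by (simp add: L2_inner_def)
qed

lemma LINT_one_unit: "(LINT x|lebesgue_on unit_ival. 1::real) = 1"
  using LINT_deriv_unit[of "\<lambda>x. x" "\<lambda>_. 1"] by simp

lemma L2_norm_bounded_unit:
  assumes "f \<in> L2 unit_ival" "\<And>x. x \<in> unit_ival \<Longrightarrow> \<bar>f x\<bar> \<le> c" "c \<ge> 0"
  shows "L2_norm unit_ival f \<le> c"
proof (rule power2_le_imp_le)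
  have "(LINT x|lebesgue_on unit_ival. f x * f x) \<le> (LINT x|lebesgue_on unit_ival. c\<^sup>2)"
  proof (rule integral_mono)
    show "integrable (lebesgue_on unit_ival) (\<lambda>x. f x * f x)"
      by (intro L2_mult_integrable assms(1))
    show "integrable (lebesgue_on unit_ival) (\<lambda>x. c\<^sup>2)"
      by (rule continuous_imp_integrable_subset[where a = 0 and b = 1]) auto
    fix x assume "x \<in> space (lebesgue_on unit_ival)"
    then have "\<bar>f x\<bar> \<le> \<bar>c\<bar>" using assms by auto
    then show "f x * f x \<le> c\<^sup>2" by (simp add: abs_le_square_iff power2_eq_square)
  qed
  also have "\<dots> = c\<^sup>2 * (LINT x|lebesgue_on unit_ival. 1)"
    by (simp only: Bochner_Integration.integral_mult_right_zero[symmetric] mult_1_right)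
  finally show "(L2_norm unit_ival f)\<^sup>2 \<le> c\<^sup>2"
    using LINT_one_unit by (simp add: L2_norm_power2 L2_inner_def)
qed (fact assms)

lemma L1_le_L2_unit:
  assumes "f \<in> L2 unit_ival"
  shows "(LINT x|lebesgue_on unit_ival. \<bar>f x\<bar>) \<le> L2_norm unit_ival f"
proof -
  have abs: "(\<lambda>x. \<bar>f x\<bar>) \<in> L2 unit_ival"
    using assms unfolding L2_def by (auto intro!: borel_measurable_abs)
  have one: "(\<lambda>_. 1) \<in> L2 unit_ival" by (intro continuous_imp_L2_unit continuous_intros)
  have "(LINT x|lebesgue_on unit_ival. \<bar>f x\<bar>) = L2_inner unit_ival (\<lambda>x. \<bar>f x\<bar>) (\<lambda>_. 1)"
    by (simp add: L2_inner_def)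
  also have "\<dots> \<le> L2_norm unit_ival (\<lambda>x. \<bar>f x\<bar>) * L2_norm unit_ival (\<lambda>_. 1)"
    using L2_Cauchy_Schwarz[OF abs one] by linarith
  also have "\<dots> = L2_norm unit_ival f"
    using LINT_one_unit by (simp add: L2_norm_def L2_inner_def)
  finally show ?thesis .
qed

text \<open>Integrating from 0 bounds \<open>h x\<close> by the L1 norm of the derivative over the
  whole interval. The length of the interval is 1, so passing to the L2 norm costs no
  constant.\<close>

lemma C1_sup_le_deriv_L2:
  assumes h: "h C1_differentiable_on UNIV" "h 0 = 0" and x: "x \<in> unit_ival"
  shows "\<bar>h x\<bar> \<le> L2_norm unit_ival (deriv h)"
proof -
  note D = C1_UNIV_has_deriv[OF h(1)]
  have A: "integrable (lebesgue_on {0..x}) (deriv h)"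
    and Aa: "integrable (lebesgue_on {0..x}) (\<lambda>t. \<bar>deriv h t\<bar>)"
    and Ia: "integrable (lebesgue_on {0..1}) (\<lambda>t. \<bar>deriv h t\<bar>)"
    and Ia': "integrable (lebesgue_on {0<..<1}) (\<lambda>t. \<bar>deriv h t\<bar>)"
    using D x by (auto intro!: continuous_imp_integrable_subset[where a = 0 and b = 1] continuous_intros)
  have "(deriv h has_integral h x - h 0) {0..x}"
    by (rule fundamental_theorem_of_calculus)
      (use x in \<open>auto intro!: has_field_derivative_at_within D simp flip: has_real_derivative_iff_has_vector_derivative\<close>)
  then have "\<bar>h x\<bar> = \<bar>integral {0..x} (deriv h)\<bar>" using h(2) by (simp add: integral_unique)
  also have "\<dots> \<le> integral {0..x} (\<lambda>t. \<bar>deriv h t\<bar>)"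
    using A Aa integral_norm_bound_integral[of "deriv h" "{0..x}" "\<lambda>t. \<bar>deriv h t\<bar>"]
    by (simp add: integrable_on_lebesgue_on)
  also have "\<dots> \<le> integral {0..1} (\<lambda>t. \<bar>deriv h t\<bar>)"
    using Aa Ia x by (intro integral_subset_le) (auto simp: integrable_on_lebesgue_on)
  also have "\<dots> = (LINT x|lebesgue_on unit_ival. \<bar>deriv h x\<bar>)"
    using Ia' by (simp add: lebesgue_integral_eq_integral integral_open_interval_real)
  also have "\<dots> \<le> L2_norm unit_ival (deriv h)"
    using D by (intro L1_le_L2_unit continuous_imp_L2_unit)
  finally show ?thesis .
qed

text \<open>Only the left end is pinned, so the bound also serves primitives that do not vanish at
  1, as the duality argument for the odd part requires.\<close>

lemma Poincare_C1:
  assumes "h C1_differentiable_on UNIV" "h 0 = 0"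
  shows "L2_norm unit_ival h \<le> L2_norm unit_ival (deriv h)"
  using C1_sup_le_deriv_L2[OF assms] C1_UNIV_has_deriv[OF assms(1)]
  by (intro L2_norm_bounded_unit continuous_imp_L2_unit) auto

lemma continuous_has_primitive:
  fixes k :: "real \<Rightarrow> real"
  assumes "continuous_on UNIV k"
  obtains H where "H 0 = 0" "\<And>x. (H has_real_derivative k x) (at x)"
proof (rule that[of "\<lambda>u::real. LBINT y=(0::real)..u. k y"])
  let ?H = "\<lambda>u::real. LBINT y=(0::real)..u. k y"
  show "?H 0 = 0" by (simp add: zero_ereal_def)
  fix x :: real
  \<comment> \<open>The margin 1 puts \<open>x\<close> in the interior, so the derivative within
    \<open>{a..b}\<close> is the two-sided one; the oriented integral takes care of negative
    \<open>x\<close>.\<close>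
  define a b where "a = min 0 x - 1" and "b = max 0 x + 1"
  have "(?H has_vector_derivative k x) (at x within {a..b})"
    by (rule interval_integral_FTC2) (auto simp: a_def b_def intro: continuous_on_subset[OF assms])
  moreover have "x \<in> interior {a..b}" by (auto simp: a_def b_def)
  then have "at x within {a..b} = at x" by (rule at_within_interior)
  ultimately show "(?H has_real_derivative k x) (at x)"
    by (simp only: has_real_derivative_iff_has_vector_derivative)
qed

text \<open>On either side of \<open>{a..b}\<close> the derivative is zero, so the primitive is
  constant there; on the left the constant is its value at 0. The constant on the right is the
  integral of \<open>k\<close> and is deliberately left free: it vanishes when \<open>k\<close> has
  mean zero, but the tests for the odd part use the general case.\<close>

lemma compact_support_primitive:
  fixes k :: "real \<Rightarrow> real"
  assumes k: "continuous_on UNIV k" "\<And>x. x \<notin> {a..b} \<Longrightarrow> k x = 0" and ab: "a > 0" "b \<ge> 0"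
  obtains H where "H C1_differentiable_on UNIV" "deriv H = k"
    "\<And>x. x < a \<Longrightarrow> H x = 0" "\<And>x y. x > b \<Longrightarrow> y > b \<Longrightarrow> H x = H y"
proof -
  obtain H where H: "H 0 = 0" "\<And>x. (H has_real_derivative k x) (at x)"
    using continuous_has_primitive[OF k(1)] by blast
  have D0: "(H has_real_derivative 0) (at x within S)" if "x \<notin> {a..b}" for x S
    using has_field_derivative_at_within[OF H(2)[of x]] k(2)[OF that] by simp
  have "\<exists>c. \<forall>x\<in>{..<a}. H x = c"
    by (rule has_field_derivative_zero_constant) (auto intro!: D0)
  with H(1) ab have 1: "H x = 0" if "x < a" for x using that by auto
  have "\<exists>c. \<forall>x\<in>{b<..}. H x = c"
    by (rule has_field_derivative_zero_constant) (auto intro!: D0)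
  then have 2: "H x = H y" if "x > b" "y > b" for x y using that by auto
  show ?thesis using that[OF C1_UNIV_I[OF H(2) k(1)] 1 2] by blast
qed

section \<open>Compact supports and periodization\<close>

lemma vanishing_outside_deriv:
  fixes f :: "real \<Rightarrow> real"
  assumes f: "\<And>x. x \<notin> {a..b} \<Longrightarrow> f x = 0" and x: "x \<notin> {a..b}"
  shows "deriv f x = 0"
proof -
  have "(f has_real_derivative 0) (at x)"
    by (rule DERIV_cong_ev[THEN iffD2, OF refl _ refl DERIV_const[of 0]])
      (use x f in \<open>auto intro!: eventually_nhds_in_open[of "- {a..b}", THEN eventually_mono]\<close>)
  then show ?thesis by (rule DERIV_imp_deriv)
qed

lemma C1c_unit_I:
  assumes "f C1_differentiable_on UNIV" "\<And>x. x \<notin> {a..b} \<Longrightarrow> f x = 0" "a > 0" "b < 1"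
  shows "f \<in> C1c unit_ival"
proof -
  have "closure {x. f x \<noteq> 0} \<subseteq> {a..b}"
    using assms(2) by (intro closure_minimal) (blast, simp)
  then show ?thesis using assms by (auto simp: C1c_def)
qed

text \<open>The support is compact, hence attains its extreme points inside the open interval. The
  zero function gets the degenerate interval at \<open>1/2\<close>.\<close>

lemma C1c_unit_support:
  assumes "f \<in> C1c unit_ival"
  obtains a b where "a > 0" "b < 1" "a \<le> b" "\<And>x. x \<notin> {a..b} \<Longrightarrow> f x = 0"
proof (cases "\<exists>x. f x \<noteq> 0")
  case False
  then show ?thesis using that[of "1/2" "1/2"] by auto
next
  case True
  define K where "K = closure {x. f x \<noteq> 0}"
  have K: "K \<subseteq> unit_ival" using assms by (simp add: C1c_def K_def)
  then have "bounded K" by (rule bounded_subset[rotated]) simp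
  then have "compact K" by (simp add: K_def compact_eq_bounded_closed)
  have "{x. f x \<noteq> 0} \<subseteq> K" unfolding K_def by (rule closure_subset)
  then have "K \<noteq> {}" using True by auto
  obtain a where a: "a \<in> K" "\<forall>y\<in>K. a \<le> y"
    using compact_attains_inf[OF \<open>compact K\<close> \<open>K \<noteq> {}\<close>] by blast
  obtain b where b: "b \<in> K" "\<forall>y\<in>K. y \<le> b"
    using compact_attains_sup[OF \<open>compact K\<close> \<open>K \<noteq> {}\<close>] by blast
  show ?thesis
    using that[of a b] a b K \<open>{x. f x \<noteq> 0} \<subseteq> K\<close> by (auto simp: subset_eq)
qed

text \<open>Near any point \<open>rmod\<close> is a translation by an even integer, except across
  its jumps. There the two candidate values differ, but both lie outside \<open>{a..b}\<close>,
  where the function to be periodized vanishes.\<close>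

lemma rmod2_local:
  fixes x\<^sub>0 :: real
  assumes "0 < a" "b < 2"
  obtains k :: int where
    "\<forall>\<^sub>F x in nhds x\<^sub>0. x rmod 2 = x + 2 * of_int k \<or> (x rmod 2 \<notin> {a..b} \<and> x + 2 * of_int k \<notin> {a..b})"
proof -
  obtain k :: int where k: "x\<^sub>0 rmod 2 = x\<^sub>0 + 2 * of_int k" using rmod2_eq by blast
  define y where "y = x\<^sub>0 rmod 2"
  have y: "0 \<le> y" "y < 2" by (simp_all add: y_def rmod_nonneg rmod_less)
  have shift: "x rmod 2 = x + 2 * of_int j" if "0 \<le> x + 2 * of_int j" "x + 2 * of_int j < 2" for x and j :: int
    by (rule rmod_unique[where n = "- j"]) (use that in auto)
  show ?thesis
  proof (cases "y = 0")
    case False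
    have "\<forall>\<^sub>F x in nhds x\<^sub>0. x \<in> {- 2 * of_int k<..<2 - 2 * of_int k}"
      by (rule eventually_nhds_in_open) (use k y False in \<open>auto simp: y_def\<close>)
    then have "\<forall>\<^sub>F x in nhds x\<^sub>0. x rmod 2 = x + 2 * of_int k"
      by eventually_elim (auto intro: shift)
    then show ?thesis by (intro that[of k]) (auto elim: eventually_mono)
  next
    case True
    \<comment> \<open>Left of the jump the unwrapped value lies in \<open>(-d, 0)\<close> and the
      wrapped one in \<open>(2 - d, 2)\<close>, thus below \<open>a\<close> and above
      \<open>b\<close>. The bound by 1 keeps the neighbourhood within one period on each
      side.\<close>
    define d where "d = Min {a, 2 - b, 1}"
    have d: "0 < d" "d \<le> a" "d \<le> 2 - b" "d \<le> 1" using assms by (auto simp: d_def)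
    have x0: "x\<^sub>0 + 2 * of_int k = 0" using True k by (simp add: y_def)
    have "\<forall>\<^sub>F x in nhds x\<^sub>0. x \<in> {x\<^sub>0 - d<..<x\<^sub>0 + d}"
      by (rule eventually_nhds_in_open) (use d in auto)
    then have "\<forall>\<^sub>F x in nhds x\<^sub>0. x rmod 2 = x + 2 * of_int k \<or> (x rmod 2 \<notin> {a..b} \<and> x + 2 * of_int k \<notin> {a..b})"
    proof eventually_elim
      case (elim x)
      show ?case
      proof (cases "x + 2 * of_int k \<ge> 0")
        case True
        then have "x rmod 2 = x + 2 * of_int k" using elim d x0 by (intro shift) auto
        then show ?thesis ..
      next
        case False
        then have "x rmod 2 = x + 2 * of_int (k + 1)" using elim d x0 by (intro shift) auto
        then show ?thesis using elim d x0 False assms by auto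
      qed
    qed
    then show ?thesis by (rule that)
  qed
qed

text \<open>A support that stays away from the seam leaves room for gluing: locally the
  periodization is a translate of \<open>e\<close>, so it is C1 with the periodized derivative. This
  is how interval test functions become torus test functions.\<close>

lemma C1_torus_periodize:
  assumes e: "e C1_differentiable_on UNIV" "\<And>x. x \<notin> {a..b} \<Longrightarrow> e x = 0" and ab: "0 < a" "b < 2"
  shows "\<exists>g\<in>C1_torus. \<forall>x\<in>torus2. g x = e x \<and> deriv g x = deriv e x"
proof -
  let ?g = "\<lambda>x. e (x rmod 2)" and ?g' = "\<lambda>x. deriv e (x rmod 2)"
  note D = C1_UNIV_has_deriv[OF e(1)]
  have e': "deriv e x = 0" if "x \<notin> {a..b}" for x using e(2) that by (rule vanishing_outside_deriv)
  have local: "(?g has_real_derivative ?g' x) (at x) \<and> isCont ?g' x" for x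
  proof -
    obtain k :: int where k: "\<forall>\<^sub>F z in nhds x. z rmod 2 = z + 2 * of_int k \<or> (z rmod 2 \<notin> {a..b} \<and> z + 2 * of_int k \<notin> {a..b})"
      using rmod2_local[OF ab] by blast
    have g: "\<forall>\<^sub>F z in nhds x. ?g z = e (z + 2 * of_int k)"
      and g': "\<forall>\<^sub>F z in nhds x. ?g' z = deriv e (z + 2 * of_int k)"
      using k by (eventually_elim; use e(2) e' in metis)+
    have "((\<lambda>z. e (z + 2 * of_int k)) has_real_derivative deriv e (x + 2 * of_int k) * (1 + 0)) (at x)"
      by (rule DERIV_chain2[OF D(1)]) (auto intro!: derivative_eq_intros)
    then have "(?g has_real_derivative ?g' x) (at x)"
      using DERIV_cong_ev[OF refl g refl] eventually_nhds_x_imp_x[OF g'] by simp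
    moreover have "isCont (\<lambda>z. deriv e (z + 2 * of_int k)) x"
      using continuous_on_compose2[OF D(2), of UNIV "\<lambda>z. z + 2 * of_int k"]
      by (auto intro!: continuous_intros simp: continuous_on_eq_continuous_at)
    then have "isCont ?g' x" using isCont_cong[OF g'] by simp
    ultimately show ?thesis ..
  qed
  then have C: "?g C1_differentiable_on UNIV" "deriv ?g = ?g'"
    by (auto intro!: C1_UNIV_I[of ?g ?g'] simp: continuous_on_eq_continuous_at)
  have "(x + 2) rmod 2 = x rmod 2" for x
  proof -
    obtain k :: int where "x rmod 2 = x + 2 * of_int k" using rmod2_eq by blast
    moreover have "0 \<le> x rmod 2" "x rmod 2 < 2" by (simp_all add: rmod_nonneg rmod_less)
    ultimately show ?thesis by (intro rmod_unique[where n = "1 - k"]) auto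
  qed
  then have "?g \<in> C1_torus" using C by (simp add: C1_torus_def)
  then show ?thesis using C by (intro bexI[of _ ?g]) auto
qed

section \<open>Density of test functions\<close>

lemma tendsto_zero_imp_less:
  fixes X :: "nat \<Rightarrow> real"
  assumes "X \<longlonglongrightarrow> 0" "e > 0"
  obtains n where "n \<ge> m" "X n < e"
proof -
  have "\<forall>\<^sub>F n in sequentially. X n < e" using assms by (rule order_tendstoD)
  then obtain N where "\<And>n. n \<ge> N \<Longrightarrow> X n < e" by (auto simp: eventually_sequentially)
  then show ?thesis using that[of "max m N"] by simp
qed

text \<open>Dominated convergence for the squared errors, with \<open>w\<close> as majorant.\<close>

lemma L2_norm_diff_tendsto:
  assumes f: "f \<in> L2 unit_ival" and s: "\<And>n. s n \<in> L2 unit_ival"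
    and w: "integrable (lebesgue_on unit_ival) w"
    and lim: "AE x in lebesgue_on unit_ival. (\<lambda>n. s n x) \<longlonglongrightarrow> f x"
    and bound: "\<And>n x. x \<in> unit_ival \<Longrightarrow> (f x - s n x)\<^sup>2 \<le> w x"
  shows "(\<lambda>n. L2_norm unit_ival (\<lambda>x. f x - s n x)) \<longlonglongrightarrow> 0"
proof -
  have "(\<lambda>n. LINT x|lebesgue_on unit_ival. (f x - s n x) * (f x - s n x)) \<longlonglongrightarrow> (LINT x|lebesgue_on unit_ival. 0::real)"
  proof (rule integral_dominated_convergence[OF _ _ w])
    show "(\<lambda>x. (f x - s n x) * (f x - s n x)) \<in> borel_measurable (lebesgue_on unit_ival)" for n
      by (intro borel_measurable_integrable L2_mult_integrable L2_diff f s)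
    show "AE x in lebesgue_on unit_ival. (\<lambda>n. (f x - s n x) * (f x - s n x)) \<longlonglongrightarrow> 0"
      using lim
    proof eventually_elim
      case (elim x)
      have "(\<lambda>n. (f x - s n x) * (f x - s n x)) \<longlonglongrightarrow> (f x - f x) * (f x - f x)"
        by (intro tendsto_intros elim)
      then show ?case by simp
    qed
    show "AE x in lebesgue_on unit_ival. norm ((f x - s n x) * (f x - s n x)) \<le> w x" for n
      by (rule AE_I2) (use bound[of _ n] in \<open>simp add: power2_eq_square\<close>)
  qed simp
  from tendsto_real_sqrt[OF this] show ?thesis
    unfolding L2_norm_def L2_inner_def by simp
qed

definition clamp_at :: "real \<Rightarrow> real \<Rightarrow> real" where
  "clamp_at M y = max (- M) (min M y)"

lemma clamp_at_bound: "M \<ge> 0 \<Longrightarrow> \<bar>clamp_at M y\<bar> \<le> M"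
  by (auto simp: clamp_at_def)

lemma clamp_at_id: "\<bar>y\<bar> \<le> M \<Longrightarrow> clamp_at M y = y"
  by (auto simp: clamp_at_def)

lemma clamp_at_diff: "M \<ge> 0 \<Longrightarrow> \<bar>y - clamp_at M y\<bar> \<le> \<bar>y\<bar>"
  by (auto simp: clamp_at_def)

lemma L2_clamp_at:
  assumes "f \<in> L2 J" "M \<ge> 0"
  shows "(\<lambda>x. clamp_at M (f x)) \<in> L2 J"
proof -
  have m: "(\<lambda>x. clamp_at M (f x)) \<in> borel_measurable (lebesgue_on J)"
    unfolding clamp_at_def
    by (intro borel_measurable_max borel_measurable_min L2_measurable[OF assms(1)]) auto
  have "integrable (lebesgue_on J) (\<lambda>x. (clamp_at M (f x))\<^sup>2)"
  proof (rule Bochner_Integration.integrable_bound)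
    show "integrable (lebesgue_on J) (\<lambda>x. (f x)\<^sup>2)" using assms by (simp add: L2_def)
    show "(\<lambda>x. (clamp_at M (f x))\<^sup>2) \<in> borel_measurable (lebesgue_on J)"
      by (intro borel_measurable_power m)
    have "\<bar>clamp_at M y\<bar> \<le> \<bar>y\<bar>" for y using assms(2) by (auto simp: clamp_at_def)
    then show "AE x in lebesgue_on J. norm ((clamp_at M (f x))\<^sup>2) \<le> norm ((f x)\<^sup>2)"
      by (simp add: abs_le_square_iff)
  qed
  with m show ?thesis by (simp add: L2_def)
qed

text \<open>Continuity suffices because these functions stand for derivatives: their primitives are
  then C1. Explicit endpoints are what the lemmas on primitives and periodization work with.\<close>

definition Cc_unit :: "(real \<Rightarrow> real) set" where
  "Cc_unit = {k. continuous_on UNIV k \<and>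
     (\<exists>a>0. \<exists>b\<ge>0. b < 1 \<and> (\<forall>x. x \<notin> {a..b} \<longrightarrow> k x = 0))}"

lemma Cc_unit_continuous: "k \<in> Cc_unit \<Longrightarrow> continuous_on UNIV k"
  by (simp add: Cc_unit_def)

lemma Cc_unit_L2: "k \<in> Cc_unit \<Longrightarrow> k \<in> L2 unit_ival"
  by (simp add: Cc_unit_def continuous_imp_L2_unit)

lemma Cc_unit_lincomb:
  assumes "k \<in> Cc_unit" "l \<in> Cc_unit"
  shows "(\<lambda>x. k x - t * l x) \<in> Cc_unit"
proof -
  obtain a b where k: "0 < a" "0 \<le> b" "b < 1" "\<And>x. x \<notin> {a..b} \<Longrightarrow> k x = 0"
    using assms(1) by (auto simp: Cc_unit_def)
  obtain c d where l: "0 < c" "0 \<le> d" "d < 1" "\<And>x. x \<notin> {c..d} \<Longrightarrow> l x = 0"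
    using assms(2) by (auto simp: Cc_unit_def)
  have "continuous_on UNIV (\<lambda>x. k x - t * l x)"
    using assms by (intro continuous_intros Cc_unit_continuous)
  moreover have "k x - t * l x = 0" if "x \<notin> {min a c..max b d}" for x
  proof -
    have "x \<notin> {a..b}" "x \<notin> {c..d}" using that by auto
    then show ?thesis using k(4) l(4) by simp
  qed
  ultimately show ?thesis
    using k l unfolding Cc_unit_def
    by (intro CollectI conjI exI[of _ "min a c"] exI[of _ "max b d"]) auto
qed

text \<open>Measurability supplies continuous functions converging almost everywhere. Clamping at
  \<open>M\<close> gives them a common bound, a cutoff moves their supports into the open interval,
  and dominated convergence applies.\<close>

lemma L2_unit_dense_bounded:
  assumes f: "f \<in> L2 unit_ival" "\<And>x. \<bar>f x\<bar> \<le> M" and e: "e > 0"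
  obtains k where "k \<in> Cc_unit"
    "L2_norm unit_ival (\<lambda>x. f x - k x) < e"
proof -
  have M: "M \<ge> 0" using f(2)[of 0] by linarith
  have "f measurable_on unit_ival"
    using L2_measurable[OF f(1)] by (simp add: measurable_on_iff_borel_measurable)
  then obtain N g where N: "negligible N" and g: "\<And>n. continuous_on UNIV (g n)"
    and lim: "\<And>x. x \<notin> N \<Longrightarrow> (\<lambda>n. g n x) \<longlonglongrightarrow> (if x \<in> unit_ival then f x else 0)"
    by (auto simp: measurable_on_def)
  \<comment> \<open>Zero within \<open>1 / n\<close> of the ends, one at distance at least
    \<open>2 / n\<close> from them, and linear between; hence it tends to 1 at each interior
    point.\<close>
  define cut where "cut n x = max 0 (min 1 (real n * min x (1 - x) - 1))" for n :: nat and x :: real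
  define k where "k n x = cut n x * clamp_at M (g n x)" for n x
  have k_cont: "continuous_on UNIV (k n)" for n
    unfolding k_def cut_def clamp_at_def by (intro continuous_intros g)
  have k_bound: "\<bar>k n x\<bar> \<le> M" for n x
  proof -
    have "\<bar>cut n x\<bar> \<le> 1" by (auto simp: cut_def)
    then have "\<bar>cut n x\<bar> * \<bar>clamp_at M (g n x)\<bar> \<le> 1 * M"
      using clamp_at_bound[OF M] by (intro mult_mono) auto
    then show ?thesis by (simp add: k_def abs_mult)
  qed
  have k_lim: "(\<lambda>n. k n x) \<longlonglongrightarrow> f x" if x: "x \<in> unit_ival" "x \<notin> N" for x
  proof -
    have "filterlim (\<lambda>n. - 1 + min x (1 - x) * real n) at_top sequentially"
      by (intro filterlim_tendsto_add_at_top[OF tendsto_const]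
          filterlim_tendsto_pos_mult_at_top[OF tendsto_const] filterlim_real_sequentially)
        (use x in auto)
    then have "\<forall>\<^sub>F n in sequentially. - 1 + min x (1 - x) * real n \<ge> 1"
      unfolding filterlim_at_top by (rule spec)
    then have "\<forall>\<^sub>F n in sequentially. cut n x = 1"
      by eventually_elim (auto simp: cut_def mult.commute)
    then have "(\<lambda>n. cut n x) \<longlonglongrightarrow> 1" by (rule tendsto_eventually)
    moreover have "(\<lambda>n. clamp_at M (g n x)) \<longlonglongrightarrow> clamp_at M (f x)"
      unfolding clamp_at_def using lim[OF x(2)] x(1) by (intro tendsto_intros) simp
    ultimately have "(\<lambda>n. cut n x * clamp_at M (g n x)) \<longlonglongrightarrow> 1 * clamp_at M (f x)"
      by (rule tendsto_mult)
    then show ?thesis using f(2) by (simp add: k_def clamp_at_id)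
  qed
  have "(\<lambda>n. L2_norm unit_ival (\<lambda>x. f x - k n x)) \<longlonglongrightarrow> 0"
  proof (rule L2_norm_diff_tendsto[where w = "\<lambda>_. (2 * M)\<^sup>2"])
    show "integrable (lebesgue_on unit_ival) (\<lambda>_. (2 * M)\<^sup>2)"
      by (rule continuous_imp_integrable_subset[where a = 0 and b = 1]) auto
    have "AE x in lebesgue. x \<notin> N" using N by (intro AE_not_in) (simp add: negligible_iff_null_sets)
    then have "AE x in lebesgue. x \<in> unit_ival \<longrightarrow> (\<lambda>n. k n x) \<longlonglongrightarrow> f x"
      by eventually_elim (use k_lim in auto)
    then show "AE x in lebesgue_on unit_ival. (\<lambda>n. k n x) \<longlonglongrightarrow> f x"
      by (simp add: AE_restrict_space_iff)
    show "(f x - k n x)\<^sup>2 \<le> (2 * M)\<^sup>2" for n x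
    proof -
      have "\<bar>f x - k n x\<bar> \<le> \<bar>2 * M\<bar>" using f(2)[of x] k_bound[of n x] M by linarith
      then show ?thesis by (simp only: abs_le_square_iff)
    qed
  qed (auto intro: f continuous_imp_L2_unit k_cont)
  then obtain n where n: "n \<ge> 2" "L2_norm unit_ival (\<lambda>x. f x - k n x) < e"
    using e by (rule tendsto_zero_imp_less)
  have supp: "k n x = 0" if "x \<notin> {1 / real n..1 - 1 / real n}" for x
  proof -
    have "min x (1 - x) < 1 / real n" using that by auto
    then have "real n * min x (1 - x) < real n * (1 / real n)"
      using n(1) by (intro mult_strict_left_mono) auto
    then show ?thesis using n(1) by (simp add: k_def cut_def)
  qed
  have "k n \<in> Cc_unit"
    unfolding Cc_unit_def
    by (intro CollectI conjI k_cont exI[of _ "1 / real n"] exI[of _ "1 - 1 / real n"] allI impI supp)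
      (use n(1) in auto)
  with n(2) show ?thesis using that by blast
qed

text \<open>Truncation at height \<open>n\<close> reduces to bounded functions; the squared
  truncation error is dominated by the square of \<open>f\<close>. Each of the two approximations
  takes half of \<open>e\<close>.\<close>

lemma L2_unit_dense:
  assumes f: "f \<in> L2 unit_ival" and e: "e > 0"
  obtains k where "k \<in> Cc_unit"
    "L2_norm unit_ival (\<lambda>x. f x - k x) < e"
proof -
  let ?c = "\<lambda>n x. clamp_at (real n) (f x)"
  have "(\<lambda>n. L2_norm unit_ival (\<lambda>x. f x - ?c n x)) \<longlonglongrightarrow> 0"
  proof (rule L2_norm_diff_tendsto[where w = "\<lambda>x. (f x)\<^sup>2"])
    show "integrable (lebesgue_on unit_ival) (\<lambda>x. (f x)\<^sup>2)" using f by (simp add: L2_def)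
    show "AE x in lebesgue_on unit_ival. (\<lambda>n. ?c n x) \<longlonglongrightarrow> f x"
    proof (rule AE_I2)
      fix x
      obtain m :: nat where "\<bar>f x\<bar> \<le> real m" using real_arch_simple by blast
      then have "\<forall>\<^sub>F n in sequentially. ?c n x = f x"
        by (intro eventually_sequentiallyI[of m] clamp_at_id) simp
      then show "(\<lambda>n. ?c n x) \<longlonglongrightarrow> f x" by (rule tendsto_eventually)
    qed
    show "(f x - ?c n x)\<^sup>2 \<le> (f x)\<^sup>2" for n x
      using clamp_at_diff[of "real n" "f x"] by (simp add: abs_le_square_iff)
  qed (auto intro: f L2_clamp_at)
  moreover have "e / 2 > 0" using e by simp
  ultimately obtain n where n: "n \<ge> (0::nat)" "L2_norm unit_ival (\<lambda>x. f x - ?c n x) < e / 2"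
    by (rule tendsto_zero_imp_less)
  have c: "?c n \<in> L2 unit_ival" by (intro L2_clamp_at f) simp
  have "e / 2 > 0" using e by simp
  then obtain k where k: "k \<in> Cc_unit"
    "L2_norm unit_ival (\<lambda>x. ?c n x - k x) < e / 2"
    by (rule L2_unit_dense_bounded[OF c clamp_at_bound[OF of_nat_0_le_iff]])
  have "L2_norm unit_ival (\<lambda>x. f x - k x)
      = L2_norm unit_ival (\<lambda>x. (f x - ?c n x) + (?c n x - k x))" by simp
  also have "\<dots> \<le> L2_norm unit_ival (\<lambda>x. f x - ?c n x) + L2_norm unit_ival (\<lambda>x. ?c n x - k x)"
    by (intro L2_norm_triangle L2_diff f c Cc_unit_L2 k)
  also have "\<dots> < e" using n k(2) by linarith
  finally show ?thesis using k(1) that by blast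
qed

text \<open>The mean of an approximant \<open>k\<close> is removed by subtracting a multiple of a
  fixed \<open>\<eta>\<close> in \<open>Cc_unit\<close> with integral above \<open>1 / 2\<close>. As
  \<open>f\<close> has mean zero, the mean of \<open>k\<close> is bounded by its approximation
  error, so the correction is small as well.\<close>

lemma L2_unit_dense_mean_zero:
  assumes f: "f \<in> L2 unit_ival" "L2_inner unit_ival f (\<lambda>_. 1) = 0" and e: "e > 0"
  obtains k where "k \<in> Cc_unit"
    "L2_inner unit_ival k (\<lambda>_. 1) = 0" "L2_norm unit_ival (\<lambda>x. f x - k x) < e"
proof -
  let ?I = "\<lambda>g. L2_inner unit_ival g (\<lambda>_. 1)" and ?N = "L2_norm unit_ival"
  have one: "(\<lambda>_. 1) \<in> L2 unit_ival" by (intro continuous_imp_L2_unit continuous_intros)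
  have I_one: "?I (\<lambda>_. 1) = 1" using LINT_one_unit by (simp add: L2_inner_def)
  have N_one: "?N (\<lambda>_. 1) = 1" using I_one by (simp add: L2_norm_def)
  have I_le: "\<bar>?I g\<bar> \<le> ?N g" if "g \<in> L2 unit_ival" for g
    using L2_Cauchy_Schwarz[OF that one] N_one by simp
  obtain \<eta> where \<eta>: "\<eta> \<in> Cc_unit"
    "?N (\<lambda>x. 1 - \<eta> x) < 1 / 2"
    by (rule L2_unit_dense[OF one, of "1 / 2"]) auto
  have \<eta>L: "\<eta> \<in> L2 unit_ival" by (intro Cc_unit_L2 \<eta>)
  have "\<bar>?I (\<lambda>x. 1 - \<eta> x)\<bar> < 1 / 2" using I_le[OF L2_diff[OF one \<eta>L]] \<eta>(2) by linarith
  moreover have "?I (\<lambda>x. 1 - \<eta> x) = 1 - ?I \<eta>"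
    using I_one by (simp only: L2_inner_diff_left[OF one \<eta>L one])
  ultimately have pos: "?I \<eta> > 1 / 2" by linarith
  \<comment> \<open>The coefficient \<open>t\<close> is at most twice the error of \<open>k\<close>,
    so the total error is at most \<open>B\<close> times that error.\<close>
  define B where "B = 1 + 2 * ?N \<eta>"
  have B: "B > 0" using L2_norm_nonneg[of unit_ival \<eta>] by (simp add: B_def add_pos_nonneg)
  then have "e / B > 0" using e by simp
  then obtain k where k: "k \<in> Cc_unit"
    "?N (\<lambda>x. f x - k x) < e / B"
    by (rule L2_unit_dense[OF f(1)])
  have kL: "k \<in> L2 unit_ival" by (intro Cc_unit_L2 k)
  define t where "t = ?I k / ?I \<eta>"
  have "\<bar>?I k\<bar> \<le> ?N (\<lambda>x. f x - k x)"
    using I_le[OF L2_diff[OF f(1) kL]] f(2) by (simp add: L2_inner_diff_left one f(1) kL)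
  then have t: "\<bar>t\<bar> \<le> 2 * ?N (\<lambda>x. f x - k x)"
    using pos mult_left_mono[of "1/2" "?I \<eta>" "2 * ?N (\<lambda>x. f x - k x)"]
    by (simp add: t_def pos_divide_le_eq)
  show ?thesis
  proof (rule that[of "\<lambda>x. k x - t * \<eta> x"])
    show "(\<lambda>x. k x - t * \<eta> x) \<in> Cc_unit" by (intro Cc_unit_lincomb k \<eta>)
    show "?I (\<lambda>x. k x - t * \<eta> x) = 0"
      using pos by (simp add: L2_inner_diff_left[OF kL L2_scale[OF \<eta>L] one] L2_inner_scale_left) (simp add: t_def)
    have "?N (\<lambda>x. f x - (k x - t * \<eta> x)) = ?N (\<lambda>x. (f x - k x) + t * \<eta> x)"
      by (rule L2_norm_cong) simp
    also have "\<dots> \<le> ?N (\<lambda>x. f x - k x) + \<bar>t\<bar> * ?N \<eta>"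
      using L2_norm_triangle[OF L2_diff[OF f(1) kL] L2_scale[OF \<eta>L, of t]] by (simp add: L2_norm_scale)
    also have "\<dots> \<le> ?N (\<lambda>x. f x - k x) * B"
      using mult_right_mono[OF t L2_norm_nonneg[of unit_ival \<eta>]] by (simp add: B_def algebra_simps)
    also have "\<dots> < e / B * B" using k(2) B by (rule mult_strict_right_mono)
    finally show "?N (\<lambda>x. f x - (k x - t * \<eta> x)) < e" using B by simp
  qed
qed

text \<open>Mean zero makes the primitive of the approximant return to 0 at 1, so it vanishes on
  both sides of its interval and is itself a test function.\<close>

lemma C1c_deriv_dense:
  assumes "p \<in> L2 unit_ival" "L2_inner unit_ival p (\<lambda>_. 1) = 0" "e > 0"
  obtains \<phi> where "\<phi> \<in> C1c unit_ival" "L2_norm unit_ival (\<lambda>x. p x - deriv \<phi> x) < e"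
proof -
  obtain k where K: "k \<in> Cc_unit"
    "L2_inner unit_ival k (\<lambda>_. 1) = 0" "L2_norm unit_ival (\<lambda>x. p x - k x) < e"
    by (rule L2_unit_dense_mean_zero[OF assms])
  then obtain a b where k: "0 < a" "0 \<le> b" "b < 1" "continuous_on UNIV k" "\<And>x. x \<notin> {a..b} \<Longrightarrow> k x = 0"
    by (auto simp: Cc_unit_def)
  obtain H where H: "H C1_differentiable_on UNIV" "deriv H = k" "\<And>x. x < a \<Longrightarrow> H x = 0"
    "\<And>x y. x > b \<Longrightarrow> y > b \<Longrightarrow> H x = H y"
    using compact_support_primitive[OF k(4,5,1,2)] by blast
  have "H 1 - H 0 = (LINT x|lebesgue_on unit_ival. k x)"
    using C1_UNIV_has_deriv[OF H(1)] H(2) by (intro LINT_deriv_unit[symmetric]) auto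
  then have "H 1 = 0" using K(2) k(1) H(3) by (simp add: L2_inner_def)
  then have "H x = 0" if "x \<notin> {a..b}" for x
    using that H(3)[of x] H(4)[of x 1] k(3) by auto
  then have "H \<in> C1c unit_ival" using H(1) k by (intro C1c_unit_I)
  then show ?thesis using that H(2) K(3) by blast
qed

text \<open>Taking \<open>k\<close> close to \<open>u\<close> makes the pairing with
  \<open>k\<close> close to the squared norm of \<open>u\<close>. A bound on pairings is the form in
  which information about a weak derivative is available.\<close>

lemma L2_norm_le_by_duality:
  assumes u: "u \<in> L2 unit_ival" and c: "c \<ge> 0"
    and dual: "\<And>k. k \<in> Cc_unit \<Longrightarrow> L2_inner unit_ival u k \<le> c * L2_norm unit_ival k"
  shows "L2_norm unit_ival u \<le> c"
proof -
  let ?N = "L2_norm unit_ival"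
  have "?N u * ?N u \<le> c * ?N u + e" if e: "e > 0" for e
  proof -
    \<comment> \<open>Collects the coefficients of the error \<open>?d\<close> in the estimate
      below; the summand 1 keeps it positive.\<close>
    define B where "B = ?N u + c + 1"
    have B: "B > 0" using c by (simp add: B_def add_nonneg_pos)
    then have "e / B > 0" using e by simp
    then obtain k where k: "k \<in> Cc_unit"
      "?N (\<lambda>x. u x - k x) < e / B"
      by (rule L2_unit_dense[OF u])
    have kL: "k \<in> L2 unit_ival" by (intro Cc_unit_L2 k)
    let ?d = "?N (\<lambda>x. u x - k x)"
    have d: "?N (\<lambda>x. (-1) * (u x - k x)) = ?d" by (subst L2_norm_scale) simp
    have "?N k = ?N (\<lambda>x. u x + (-1) * (u x - k x))" by simp
    also have "\<dots> \<le> ?N u + ?N (\<lambda>x. (-1) * (u x - k x))"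
      by (intro L2_norm_triangle u L2_scale L2_diff kL)
    finally have kN: "?N k \<le> ?N u + ?d" using d by simp
    have "?N u * ?N u = L2_inner unit_ival u (\<lambda>x. (u x - k x) + k x)"
      using L2_norm_power2[of unit_ival u] by (simp add: power2_eq_square)
    also have "\<dots> = L2_inner unit_ival u (\<lambda>x. u x - k x) + L2_inner unit_ival u k"
      by (intro L2_inner_add_right u L2_diff kL)
    also have "\<dots> \<le> ?N u * ?d + c * ?N k"
      using L2_Cauchy_Schwarz[OF u L2_diff[OF u kL]] dual[OF k(1)] by (intro add_mono) auto
    also have "\<dots> \<le> ?N u * ?d + c * (?N u + ?d)"
      using kN c by (intro add_left_mono mult_left_mono)
    also have "\<dots> \<le> c * ?N u + B * ?d"
      using L2_norm_nonneg[of unit_ival "\<lambda>x. u x - k x"] by (simp add: B_def algebra_simps)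
    also have "\<dots> \<le> c * ?N u + B * (e / B)"
      using k(2) B by (intro add_left_mono mult_left_mono) auto
    finally show ?thesis using B by simp
  qed
  then have "?N u * ?N u \<le> c * ?N u" by (rule field_le_epsilon)
  then show ?thesis
    using L2_norm_nonneg[of unit_ival u] c by (cases "?N u = 0") (auto simp: mult_le_cancel_right)
qed

section \<open>Reflection of Sobolev functions\<close>

lemma C1c_C1: "f \<in> C1c J \<Longrightarrow> f C1_differentiable_on UNIV"
  by (simp add: C1c_def)

lemma C1_imp_L2_unit:
  assumes "f C1_differentiable_on UNIV"
  shows "f \<in> L2 unit_ival" "deriv f \<in> L2 unit_ival"
  using C1_UNIV_has_deriv[OF assms] by (auto intro: continuous_imp_L2_unit)

lemma C1_imp_L2_torus2:
  assumes "f C1_differentiable_on UNIV"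
  shows "f \<in> L2 torus2" "deriv f \<in> L2 torus2"
  using C1_UNIV_has_deriv[OF assms] by (auto intro: continuous_imp_L2_torus2)

lemma C1_UNIV_diff:
  fixes f g :: "real \<Rightarrow> real"
  assumes "f C1_differentiable_on UNIV" "g C1_differentiable_on UNIV"
  shows "(\<lambda>x. f x - g x) C1_differentiable_on UNIV"
    and "deriv (\<lambda>x. f x - g x) = (\<lambda>x. deriv f x - deriv g x)"
proof -
  note f = C1_UNIV_has_deriv[OF assms(1)] and g = C1_UNIV_has_deriv[OF assms(2)]
  have 1: "((\<lambda>x. f x - g x) has_real_derivative deriv f x - deriv g x) (at x)" for x
    by (intro DERIV_diff f g)
  have 2: "continuous_on UNIV (\<lambda>x. deriv f x - deriv g x)"
    by (intro continuous_intros f g)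
  show "(\<lambda>x. f x - g x) C1_differentiable_on UNIV"
    and "deriv (\<lambda>x. f x - g x) = (\<lambda>x. deriv f x - deriv g x)"
    using C1_UNIV_I[OF 1 2] by simp_all
qed

lemma C1_UNIV_refl_sum:
  assumes "g C1_differentiable_on UNIV"
  shows "refl_sum s g C1_differentiable_on UNIV"
    and "deriv (refl_sum s g) = refl_sum (- s) (deriv g)"
proof -
  note g = C1_UNIV_has_deriv[OF assms]
  have "((\<lambda>x. g (2 - x)) has_real_derivative deriv g (2 - x) * (0 - 1)) (at x)" for x
    by (rule DERIV_chain2[OF g(1)]) (auto intro!: derivative_eq_intros)
  then have 1: "(refl_sum s g has_real_derivative refl_sum (- s) (deriv g) x) (at x)" for x
    unfolding refl_sum_def[abs_def] by (auto intro!: derivative_eq_intros g(1))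
  have "continuous_on UNIV (\<lambda>x. deriv g (2 - x))"
    by (rule continuous_on_compose2[OF g(2)]) (auto intro!: continuous_intros)
  then have 2: "continuous_on UNIV (refl_sum (- s) (deriv g))"
    unfolding refl_sum_def[abs_def] by (intro continuous_intros g)
  show "refl_sum s g C1_differentiable_on UNIV"
    and "deriv (refl_sum s g) = refl_sum (- s) (deriv g)"
    using C1_UNIV_I[OF 1 2] by simp_all
qed

lemma zero_if_le_all_eps:
  fixes x :: real
  assumes "\<And>e. e > 0 \<Longrightarrow> \<bar>x\<bar> \<le> c * e" "c \<ge> 0"
  shows "x = 0"
proof (rule ccontr)
  assume "x \<noteq> 0"
  define d where "d = c + 1"
  have d: "d > 0" "c \<le> d" using assms(2) by (auto simp: d_def)
  have e: "\<bar>x\<bar> / (2 * d) > 0" using d \<open>x \<noteq> 0\<close> by simp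
  have "c * (\<bar>x\<bar> / (2 * d)) \<le> d * (\<bar>x\<bar> / (2 * d))"
    using e d by (intro mult_right_mono) auto
  also have "\<dots> = \<bar>x\<bar> / 2" using d by simp
  finally show False using assms(1)[OF e] \<open>x \<noteq> 0\<close> by linarith
qed

text \<open>The definition of \<open>H1\<close> allows only tests with compact support, whereas
  \<open>h\<close> merely vanishes at the ends. Its derivative has mean zero, so it is approximated
  by derivatives of test functions, and Poincare's inequality makes the functions themselves
  converge too.\<close>

lemma H1_by_parts:
  assumes f: "(f, f') \<in> H1" and h: "h C1_differentiable_on UNIV" "h 0 = 0" "h 1 = 0"
  shows "L2_inner unit_ival f (deriv h) = - L2_inner unit_ival f' h"
proof -
  let ?I = "L2_inner unit_ival" and ?N = "L2_norm unit_ival"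
  have L: "f \<in> L2 unit_ival" "f' \<in> L2 unit_ival"
    and weak: "\<And>\<phi>. \<phi> \<in> C1c unit_ival \<Longrightarrow> ?I f (deriv \<phi>) = - ?I f' \<phi>"
    using f by (auto simp: H1_def weak_deriv_def)
  note hL = C1_imp_L2_unit[OF h(1)]
  have mean: "?I (deriv h) (\<lambda>_. 1) = 0"
    using LINT_deriv_unit[of h "deriv h"] C1_UNIV_has_deriv[OF h(1)] h(2,3) by (simp add: L2_inner_def)
  have "?I f (deriv h) + ?I f' h = 0"
  proof (rule zero_if_le_all_eps)
    fix e :: real assume "e > 0"
    then obtain \<phi> where \<phi>: "\<phi> \<in> C1c unit_ival" "?N (\<lambda>x. deriv h x - deriv \<phi> x) < e"
      by (rule C1c_deriv_dense[OF hL(2) mean])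
    note \<phi>1 = C1c_C1[OF \<phi>(1)]
    note \<phi>L = C1_imp_L2_unit[OF \<phi>1] and d = C1_UNIV_diff[OF h(1) \<phi>1]
    have "\<phi> 0 = 0" using C1c_unit_support[OF \<phi>(1)] by (metis atLeastAtMost_iff not_le)
    then have "?N (\<lambda>x. h x - \<phi> x) \<le> ?N (\<lambda>x. deriv h x - deriv \<phi> x)"
      using Poincare_C1[OF d(1)] h(2) by (simp add: d(2))
    then have n: "?N (\<lambda>x. h x - \<phi> x) \<le> e" using \<phi>(2) by linarith
    have eq: "?I f (deriv h) + ?I f' h = ?I f (\<lambda>x. deriv h x - deriv \<phi> x) + ?I f' (\<lambda>x. h x - \<phi> x)"
      using weak[OF \<phi>(1)] by (simp add: L2_inner_diff_right L hL \<phi>L)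
    have "\<bar>?I f (\<lambda>x. deriv h x - deriv \<phi> x)\<bar> \<le> ?N f * e"
      by (rule order_trans[OF L2_Cauchy_Schwarz[OF L(1) L2_diff[OF hL(2) \<phi>L(2)]]])
        (intro mult_left_mono less_imp_le[OF \<phi>(2)] L2_norm_nonneg)
    moreover have "\<bar>?I f' (\<lambda>x. h x - \<phi> x)\<bar> \<le> ?N f' * e"
      by (rule order_trans[OF L2_Cauchy_Schwarz[OF L(2) L2_diff[OF hL(1) \<phi>L(1)]]])
        (intro mult_left_mono n L2_norm_nonneg)
    ultimately show "\<bar>?I f (deriv h) + ?I f' h\<bar> \<le> (?N f + ?N f') * e"
      unfolding eq distrib_right by linarith
  qed simp
  then show ?thesis by linarith
qed

text \<open>Here \<open>f\<close> is approximated instead of \<open>h\<close>. Its approximants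
  vanish at both ends, which removes the boundary term for every C1 function
  \<open>h\<close>.\<close>

lemma H10_by_parts:
  assumes f: "(f, f') \<in> H10" and h: "h C1_differentiable_on UNIV"
  shows "L2_inner unit_ival f (deriv h) = - L2_inner unit_ival f' h"
proof -
  let ?I = "L2_inner unit_ival" and ?N = "L2_norm unit_ival"
  have L: "f \<in> L2 unit_ival" "f' \<in> L2 unit_ival"
    and dense: "\<And>e. e > 0 \<Longrightarrow> \<exists>\<phi>\<in>C1c unit_ival. sqrt ((?N (\<lambda>x. \<phi> x - f x))\<^sup>2 + (?N (\<lambda>x. deriv \<phi> x - f' x))\<^sup>2) < e"
    using f by (auto simp: H10_def H1_def weak_deriv_def)
  note hL = C1_imp_L2_unit[OF h(1)]
  have "?I f (deriv h) + ?I f' h = 0"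
  proof (rule zero_if_le_all_eps)
    fix e :: real assume "e > 0"
    then obtain \<phi> where \<phi>: "\<phi> \<in> C1c unit_ival"
      "sqrt ((?N (\<lambda>x. \<phi> x - f x))\<^sup>2 + (?N (\<lambda>x. deriv \<phi> x - f' x))\<^sup>2) < e"
      using dense by blast
    have n: "?N (\<lambda>x. \<phi> x - f x) \<le> e" "?N (\<lambda>x. deriv \<phi> x - f' x) \<le> e"
      using \<phi>(2) real_sqrt_sum_squares_ge1[of "?N (\<lambda>x. \<phi> x - f x)" "?N (\<lambda>x. deriv \<phi> x - f' x)"]
        real_sqrt_sum_squares_ge2[of "?N (\<lambda>x. deriv \<phi> x - f' x)" "?N (\<lambda>x. \<phi> x - f x)"] by linarith+
    note \<phi>1 = C1c_C1[OF \<phi>(1)]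
    note \<phi>L = C1_imp_L2_unit[OF \<phi>1]
    obtain a b where ab: "0 < a" "b < 1" "\<And>x. x \<notin> {a..b} \<Longrightarrow> \<phi> x = 0"
      by (rule C1c_unit_support[OF \<phi>(1)]) blast
    have "\<phi> 0 = 0" "\<phi> 1 = 0" using ab by auto
    then have "?I \<phi> (deriv h) = - ?I (deriv \<phi>) h"
      using \<phi>1 h by (intro L2_inner_by_parts_C1) simp_all
    then have "- (?I f (deriv h) + ?I f' h) = ?I (\<lambda>x. \<phi> x - f x) (deriv h) + ?I (\<lambda>x. deriv \<phi> x - f' x) h"
      by (simp add: L2_inner_diff_left L hL \<phi>L)
    moreover have "\<bar>?I (\<lambda>x. \<phi> x - f x) (deriv h)\<bar> \<le> e * ?N (deriv h)"
      by (rule order_trans[OF L2_Cauchy_Schwarz[OF L2_diff[OF \<phi>L(1) L(1)] hL(2)]])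
        (intro mult_right_mono n L2_norm_nonneg)
    moreover have "\<bar>?I (\<lambda>x. deriv \<phi> x - f' x) h\<bar> \<le> e * ?N h"
      by (rule order_trans[OF L2_Cauchy_Schwarz[OF L2_diff[OF \<phi>L(2) L(2)] hL(1)]])
        (intro mult_right_mono n L2_norm_nonneg)
    moreover have "(?N (deriv h) + ?N h) * e = e * ?N (deriv h) + e * ?N h" by (simp add: algebra_simps)
    ultimately show "\<bar>?I f (deriv h) + ?I f' h\<bar> \<le> (?N (deriv h) + ?N h) * e" by linarith
  qed simp
  then show ?thesis by linarith
qed

text \<open>The adjoint turns the pairing with \<open>deriv g\<close> into one with
  \<open>refl_sum s (deriv g)\<close>, which is the derivative of \<open>refl_sum (- s) g\<close>.
  This is the origin of the opposite sign on the derivative.\<close>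

lemma refl_ext_in_H1_torus:
  assumes L: "f \<in> L2 unit_ival" "f' \<in> L2 unit_ival"
    and parts: "\<And>g. g \<in> C1_torus \<Longrightarrow>
      L2_inner unit_ival f (deriv (refl_sum (- s) g)) = - L2_inner unit_ival f' (refl_sum (- s) g)"
  shows "(refl_ext s f, refl_ext (- s) f') \<in> H1_torus"
proof -
  have "L2_inner torus2 (refl_ext s f) (deriv g) = - L2_inner torus2 (refl_ext (- s) f') g"
    if g: "g \<in> C1_torus" for g
  proof -
    have C: "g C1_differentiable_on UNIV" using g by (simp add: C1_torus_def)
    show ?thesis
      using parts[OF g] C1_UNIV_refl_sum(2)[OF C, of "- s"]
      by (simp add: L2_inner_refl_ext[OF L(1) C1_imp_L2_torus2(2)[OF C]]
          L2_inner_refl_ext[OF L(2) C1_imp_L2_torus2(1)[OF C]])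
  qed
  then show ?thesis using L by (simp add: H1_torus_def weak_deriv_def refl_ext_L2)
qed

lemma refl_ext_H1:
  assumes "(f, f') \<in> H1"
  shows "(refl_ext 1 f, refl_ext (-1) f') \<in> H1_torus"
proof (rule refl_ext_in_H1_torus)
  show "f \<in> L2 unit_ival" "f' \<in> L2 unit_ival" using assms by (auto simp: H1_def weak_deriv_def)
  fix g :: "real \<Rightarrow> real" assume g: "g \<in> C1_torus"
  \<comment> \<open>Periodicity makes the odd fold of \<open>g\<close> vanish at 0; at 1 it vanishes
    by antisymmetry.\<close>
  then have "g 2 = g 0" by (auto simp: C1_torus_def dest: spec[of _ 0])
  then show "L2_inner unit_ival f (deriv (refl_sum (- 1) g)) = - L2_inner unit_ival f' (refl_sum (- 1) g)"
    using g by (intro H1_by_parts[OF assms] C1_UNIV_refl_sum) (auto simp: C1_torus_def refl_sum_def)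
qed

text \<open>The even fold of \<open>g\<close> has no prescribed value at 0 or 1, so the stronger
  integration by parts of \<open>H10\<close> is needed.\<close>

lemma refl_ext_H10:
  assumes "(f, f') \<in> H10"
  shows "(refl_ext (-1) f, refl_ext 1 f') \<in> H1_torus"
proof -
  have "(refl_ext (-1) f, refl_ext (- (-1)) f') \<in> H1_torus"
  proof (rule refl_ext_in_H1_torus)
    show "f \<in> L2 unit_ival" "f' \<in> L2 unit_ival" using assms by (auto simp: H10_def H1_def weak_deriv_def)
    fix g :: "real \<Rightarrow> real" assume "g \<in> C1_torus"
    then show "L2_inner unit_ival f (deriv (refl_sum (- (- 1)) g)) = - L2_inner unit_ival f' (refl_sum (- (- 1)) g)"
      by (intro H10_by_parts[OF assms] C1_UNIV_refl_sum) (auto simp: C1_torus_def)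
  qed
  then show ?thesis by simp
qed

text \<open>Adjointness for a \<open>g\<close> that has parity \<open>s\<close> on the two open
  halves but may be a smooth periodic function rather than the literal
  \<open>refl_ext s h\<close>.\<close>

lemma L2_inner_torus2_sym:
  assumes "\<psi> \<in> L2 torus2" "g \<in> L2 torus2"
    and sym: "\<And>x. x \<in> unit_ival \<Longrightarrow> g x = h x" "\<And>x. x \<in> unit_ival \<Longrightarrow> g (2 - x) = s * h x"
  shows "L2_inner torus2 \<psi> g = L2_inner unit_ival (refl_sum s \<psi>) h"
proof -
  have h: "h \<in> L2 unit_ival" using L2_torus2D(1)[OF assms(2)] L2_cong[of unit_ival g h] sym(1) by simp
  have "L2_inner torus2 \<psi> g = L2_inner unit_ival \<psi> h + L2_inner unit_ival (\<lambda>x. \<psi> (2 - x)) (\<lambda>x. s * h x)"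
    unfolding L2_inner_torus2[OF assms(1,2)]
    by (intro arg_cong2[of _ _ _ _ "(+)"] L2_inner_cong sym refl)
  also have "\<dots> = L2_inner unit_ival (refl_sum s \<psi>) h"
    unfolding refl_sum_def[abs_def] using h L2_torus2D[OF assms(1)]
    by (simp add: L2_inner_add_left L2_scale L2_inner_scale_left L2_inner_scale_right)
  finally show ?thesis .
qed

text \<open>A test function on the interval is extended with parity \<open>- s\<close>, so that its
  derivative has parity \<open>s\<close> and pairs with the fold of \<open>\<psi>\<close>. Compact
  support inside the interval lets the extension be periodized.\<close>

lemma refl_sum_H1:
  assumes \<psi>: "(\<psi>, \<psi>') \<in> H1_torus" and s: "\<bar>s\<bar> = 1"
  shows "(refl_sum s \<psi>, refl_sum (- s) \<psi>') \<in> H1"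
proof -
  have L: "\<psi> \<in> L2 torus2" "\<psi>' \<in> L2 torus2"
    and weak: "\<And>g. g \<in> C1_torus \<Longrightarrow> L2_inner torus2 \<psi> (deriv g) = - L2_inner torus2 \<psi>' g"
    using \<psi> by (auto simp: H1_torus_def weak_deriv_def)
  have ss: "s * s = 1" using s by (metis abs_mult_self_eq mult_1)
  have "L2_inner unit_ival (refl_sum s \<psi>) (deriv \<phi>) = - L2_inner unit_ival (refl_sum (- s) \<psi>') \<phi>"
    if \<phi>: "\<phi> \<in> C1c unit_ival" for \<phi>
  proof -
    obtain a b where ab: "0 < a" "b < 1" "\<And>x. x \<notin> {a..b} \<Longrightarrow> \<phi> x = 0"
      by (rule C1c_unit_support[OF \<phi>]) blast
    have d0: "deriv \<phi> x = 0" if "x \<notin> {a..b}" for x using ab(3) that by (rule vanishing_outside_deriv)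
    note e = C1_UNIV_refl_sum[OF C1c_C1[OF \<phi>], of "- s"]
    \<comment> \<open>The extension is supported in \<open>{a..b}\<close> and its mirror image; this
      margin makes \<open>{a'..2 - a'}\<close> contain both.\<close>
    define a' where "a' = min a (1 - b)"
    have a': "0 < a'" "a' \<le> a" "a' \<le> 1 - b" using ab by (auto simp: a'_def)
    have e0: "refl_sum (- s) \<phi> x = 0" if "x \<notin> {a'..2 - a'}" for x
    proof -
      have "x \<notin> {a..b}" "2 - x \<notin> {a..b}" using that ab a' by auto
      then show ?thesis using ab(3) by (simp add: refl_sum_def)
    qed
    have "\<exists>g\<in>C1_torus. \<forall>x\<in>torus2. g x = refl_sum (- s) \<phi> x \<and> deriv g x = deriv (refl_sum (- s) \<phi>) x"
      by (rule C1_torus_periodize[OF e(1) e0 a'(1)]) (use a' in auto)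
    then obtain g where g: "g \<in> C1_torus" "\<And>x. x \<in> torus2 \<Longrightarrow> g x = refl_sum (- s) \<phi> x"
      "\<And>x. x \<in> torus2 \<Longrightarrow> deriv g x = deriv (refl_sum (- s) \<phi>) x"
      by blast
    then have C: "g C1_differentiable_on UNIV" by (simp add: C1_torus_def)
    have out: "2 - x \<notin> {a..b}" if "x \<in> unit_ival" for x using that ab by auto
    have "L2_inner torus2 \<psi> (deriv g) = L2_inner unit_ival (refl_sum s \<psi>) (deriv \<phi>)"
      using out d0 by (intro L2_inner_torus2_sym L C1_imp_L2_torus2 C) (auto simp: g(3) e(2) refl_sum_def)
    moreover have "L2_inner torus2 \<psi>' g = L2_inner unit_ival (refl_sum (- s) \<psi>') \<phi>"
      using out ab(3) by (intro L2_inner_torus2_sym L C1_imp_L2_torus2 C) (auto simp: g(2) refl_sum_def)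
    ultimately show ?thesis using weak[OF g(1)] by simp
  qed
  then show ?thesis using L by (simp add: H1_def weak_deriv_def refl_sum_L2)
qed

text \<open>The even extension of a primitive of \<open>k\<close> is an admissible test function on the torus, although
  that primitive need not vanish at 1; this is how the odd part acquires zero boundary values.\<close>

lemma refl_sum_primitive_test:
  assumes \<psi>: "(\<psi>, \<psi>') \<in> H1_torus" and k: "k \<in> Cc_unit"
  obtains h where "h C1_differentiable_on UNIV" "h 0 = 0" "deriv h = k"
    "L2_inner unit_ival (refl_sum (-1) \<psi>) k = - L2_inner unit_ival (refl_sum 1 \<psi>') h"
proof -
  have L: "\<psi> \<in> L2 torus2" "\<psi>' \<in> L2 torus2"
    and weak: "\<And>g. g \<in> C1_torus \<Longrightarrow> L2_inner torus2 \<psi> (deriv g) = - L2_inner torus2 \<psi>' g"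
    using \<psi> by (auto simp: H1_torus_def weak_deriv_def)
  obtain a b where ab: "0 < a" "0 \<le> b" "b < 1" "\<And>x. x \<notin> {a..b} \<Longrightarrow> k x = 0"
    using k by (auto simp: Cc_unit_def)
  obtain h where h: "h C1_differentiable_on UNIV" "deriv h = k" "\<And>x. x < a \<Longrightarrow> h x = 0"
    "\<And>x y. x > b \<Longrightarrow> y > b \<Longrightarrow> h x = h y"
    using compact_support_primitive[OF Cc_unit_continuous[OF k] ab(4,1,2)] by blast
  \<comment> \<open>Near either end of the period one of \<open>h x\<close> and
    \<open>h (2 - x)\<close> is 0 and the other is \<open>h 1\<close>. Subtracting
    \<open>h 1\<close> makes \<open>e\<close> vanish there, while on the unit interval
    \<open>h (2 - x) = h 1\<close> and \<open>e\<close> is just \<open>h\<close>.\<close>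
  define e where "e x = refl_sum 1 h x - h 1" for x
  note r = C1_UNIV_refl_sum[OF h(1), of 1]
  have "(\<lambda>_. h 1) C1_differentiable_on UNIV" by (rule C1_UNIV_I(1)[of _ "\<lambda>_. 0"]) auto
  from C1_UNIV_diff[OF r(1) this] have e: "e C1_differentiable_on UNIV" "deriv e = refl_sum (-1) k"
    by (simp_all add: e_def[abs_def] r(2) h(2))
  define a' where "a' = min a (1 - b)"
  have a': "0 < a'" "a' \<le> a" "a' \<le> 1 - b" using ab by (auto simp: a'_def)
  have e0: "e x = 0" if "x \<notin> {a'..2 - a'}" for x
  proof -
    from that consider "x < a'" | "2 - x < a'" by force
    then show ?thesis
    proof cases
      case 1
      then have "h x = 0" "h (2 - x) = h 1" using a' ab by (auto intro!: h(3,4))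
      then show ?thesis by (simp add: e_def refl_sum_def)
    next
      case 2
      then have "h (2 - x) = 0" "h x = h 1" using a' ab by (auto intro!: h(3,4))
      then show ?thesis by (simp add: e_def refl_sum_def)
    qed
  qed
  have "\<exists>g\<in>C1_torus. \<forall>x\<in>torus2. g x = e x \<and> deriv g x = deriv e x"
    by (rule C1_torus_periodize[OF e(1) e0 a'(1)]) (use a' in auto)
  then obtain g where g: "g \<in> C1_torus" "\<And>x. x \<in> torus2 \<Longrightarrow> g x = e x"
      "\<And>x. x \<in> torus2 \<Longrightarrow> deriv g x = deriv e x"
    by blast
  then have C: "g C1_differentiable_on UNIV" by (simp add: C1_torus_def)
  have out: "2 - x \<notin> {a..b}" "h (2 - x) = h 1" if "x \<in> unit_ival" for x
    using that ab by (auto intro!: h(4))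
  have "L2_inner torus2 \<psi> (deriv g) = L2_inner unit_ival (refl_sum (-1) \<psi>) k"
    using out ab(4) by (intro L2_inner_torus2_sym L C1_imp_L2_torus2 C) (auto simp: g(3) e(2) refl_sum_def)
  moreover have "L2_inner torus2 \<psi>' g = L2_inner unit_ival (refl_sum 1 \<psi>') h"
    using out by (intro L2_inner_torus2_sym L C1_imp_L2_torus2 C) (auto simp: g(2) e_def refl_sum_def)
  ultimately show ?thesis using weak[OF g(1)] h ab(1) that by simp
qed

lemma refl_sum_H10:
  assumes \<psi>: "(\<psi>, \<psi>') \<in> H1_torus"
  shows "(refl_sum (-1) \<psi>, refl_sum 1 \<psi>') \<in> H10"
proof -
  let ?F = "refl_sum (-1) \<psi>" and ?F' = "refl_sum 1 \<psi>'"
  let ?I = "L2_inner unit_ival" and ?N = "L2_norm unit_ival"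
  have H1: "(?F, ?F') \<in> H1" using refl_sum_H1[OF \<psi>, of "-1"] by simp
  then have FL: "?F \<in> L2 unit_ival" "?F' \<in> L2 unit_ival" by (auto simp: H1_def weak_deriv_def)
  have L: "\<psi> \<in> L2 torus2" "\<psi>' \<in> L2 torus2"
    using \<psi> by (auto simp: H1_torus_def weak_deriv_def)
  have c: "(\<lambda>_. 1) C1_differentiable_on UNIV" "deriv (\<lambda>_::real. 1::real) = (\<lambda>_. 0)"
    using C1_UNIV_I[of "\<lambda>_. 1" "\<lambda>_. 0"] by simp_all
  then have "(\<lambda>_. 1) \<in> C1_torus" by (simp add: C1_torus_def)
  \<comment> \<open>Constants are periodic test functions, so a weak derivative on the torus has
    mean zero.\<close>
  then have "L2_inner torus2 \<psi>' (\<lambda>_. 1) = 0"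
    using \<psi> c(2) by (auto simp: H1_torus_def weak_deriv_def L2_inner_def dest!: bspec)
  moreover have "L2_inner torus2 \<psi>' (\<lambda>_. 1) = ?I ?F' (\<lambda>_. 1)"
    by (intro L2_inner_torus2_sym L C1_imp_L2_torus2 c) auto
  ultimately have mean: "?I ?F' (\<lambda>_. 1) = 0" by simp
  have "\<exists>\<phi>\<in>C1c unit_ival. sqrt ((?N (\<lambda>x. \<phi> x - ?F x))\<^sup>2 + (?N (\<lambda>x. deriv \<phi> x - ?F' x))\<^sup>2) < \<epsilon>"
    if "\<epsilon> > 0" for \<epsilon>
  proof -
    have "\<epsilon> / 2 > 0" using that by simp
    then obtain \<phi> where \<phi>: "\<phi> \<in> C1c unit_ival" "?N (\<lambda>x. ?F' x - deriv \<phi> x) < \<epsilon> / 2"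
      by (rule C1c_deriv_dense[OF FL(2) mean])
    note \<phi>1 = C1c_C1[OF \<phi>(1)]
    note \<phi>L = C1_imp_L2_unit[OF \<phi>1]
    obtain a b where ab: "0 < a" "b < 1" "\<And>x. x \<notin> {a..b} \<Longrightarrow> \<phi> x = 0"
      by (rule C1c_unit_support[OF \<phi>(1)]) blast
    have \<phi>0: "\<phi> 0 = 0" "\<phi> 1 = 0" using ab by auto
    \<comment> \<open>A Poincare inequality for \<open>?F - \<phi>\<close>, obtained by moving onto
      the test side: pairing with \<open>k\<close> becomes minus the pairing of the derivatives with
      a primitive \<open>h\<close> of \<open>k\<close>, and Poincare's inequality is applied to
      \<open>h\<close>.\<close>
    have "?N (\<lambda>x. ?F x - \<phi> x) \<le> ?N (\<lambda>x. ?F' x - deriv \<phi> x)"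
    proof (rule L2_norm_le_by_duality)
      fix k assume k: "k \<in> Cc_unit"
      obtain h where h: "h C1_differentiable_on UNIV" "h 0 = 0" "deriv h = k" "?I ?F k = - ?I ?F' h"
        by (rule refl_sum_primitive_test[OF \<psi> k])
      note hL = C1_imp_L2_unit[OF h(1)]
      have "?I \<phi> k = - ?I (deriv \<phi>) h"
        using L2_inner_by_parts_C1[OF \<phi>1 h(1)] \<phi>0 h(3) by simp
      then have "?I (\<lambda>x. ?F x - \<phi> x) k = - ?I (\<lambda>x. ?F' x - deriv \<phi> x) h"
        using h(4) by (simp add: L2_inner_diff_left FL \<phi>L hL Cc_unit_L2[OF k])
      also have "\<dots> \<le> ?N (\<lambda>x. ?F' x - deriv \<phi> x) * ?N h"
        using L2_Cauchy_Schwarz[OF L2_diff[OF FL(2) \<phi>L(2)] hL(1)] by linarith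
      also have "\<dots> \<le> ?N (\<lambda>x. ?F' x - deriv \<phi> x) * ?N k"
        using Poincare_C1[OF h(1,2)] h(3) by (intro mult_left_mono) auto
      finally show "?I (\<lambda>x. ?F x - \<phi> x) k \<le> ?N (\<lambda>x. ?F' x - deriv \<phi> x) * ?N k" .
    qed (intro L2_diff FL \<phi>L L2_norm_nonneg)+
    moreover have flip: "?N (\<lambda>x. u x - v x) = ?N (\<lambda>x. v x - u x)" for u v :: "real \<Rightarrow> real"
      using L2_norm_scale[of unit_ival "-1" "\<lambda>x. u x - v x"] by simp
    ultimately have "?N (\<lambda>x. \<phi> x - ?F x) + ?N (\<lambda>x. deriv \<phi> x - ?F' x) < \<epsilon>"
      using \<phi>(2) flip[of \<phi> ?F] flip[of "deriv \<phi>" ?F'] by linarith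
    then have "sqrt ((?N (\<lambda>x. \<phi> x - ?F x))\<^sup>2 + (?N (\<lambda>x. deriv \<phi> x - ?F' x))\<^sup>2) < \<epsilon>"
      using sqrt_sum_squares_le_sum[of "?N (\<lambda>x. \<phi> x - ?F x)" "?N (\<lambda>x. deriv \<phi> x - ?F' x)"] by simp
    with \<phi>(1) show ?thesis by blast
  qed
  with H1 show ?thesis by (simp add: H10_def)
qed

section \<open>Reflection of solutions\<close>

text \<open>Linearity is an equality of functions at every point, so it rewrites difference
  quotients literally; boundedness concerns the seminorm. Extension and fold are treated together in
  this form.\<close>

definition L2_operator :: "real set \<Rightarrow> real set \<Rightarrow> ((real \<Rightarrow> real) \<Rightarrow> real \<Rightarrow> real) \<Rightarrow> bool" where
  "L2_operator J K A \<longleftrightarrow>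
     (\<forall>f g c d. A (\<lambda>x. c * f x + d * g x) = (\<lambda>x. c * A f x + d * A g x)) \<and>
     (\<exists>B. \<forall>f\<in>L2 J. A f \<in> L2 K \<and> L2_norm K (A f) \<le> B * L2_norm J f)"

lemma sqrt2_bound:
  assumes "a\<^sup>2 \<le> 2 * b\<^sup>2" "b \<ge> (0::real)"
  shows "a \<le> sqrt 2 * b"
  using real_le_rsqrt[OF assms(1)] assms(2) by (simp add: real_sqrt_mult)

lemma L2_operator_refl_ext:
  assumes "\<bar>s\<bar> = 1"
  shows "L2_operator unit_ival torus2 (refl_ext s)"
  unfolding L2_operator_def
proof (intro conjI allI)
  show "refl_ext s (\<lambda>x. c * f x + d * g x) = (\<lambda>x. c * refl_ext s f x + d * refl_ext s g x)" for c d f g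
    by (auto simp: refl_ext_def algebra_simps)
  show "\<exists>B. \<forall>f\<in>L2 unit_ival. refl_ext s f \<in> L2 torus2 \<and> L2_norm torus2 (refl_ext s f) \<le> B * L2_norm unit_ival f"
    using assms by (auto intro!: exI[of _ "sqrt 2"] refl_ext_L2 sqrt2_bound simp: L2_norm_refl_ext)
qed

lemma L2_operator_refl_sum:
  assumes "s \<in> {1, -1}"
  shows "L2_operator torus2 unit_ival (refl_sum s)"
  unfolding L2_operator_def
proof (intro conjI allI)
  show "refl_sum s (\<lambda>x. c * f x + d * g x) = (\<lambda>x. c * refl_sum s f x + d * refl_sum s g x)" for c d f g
    by (auto simp: refl_sum_def algebra_simps)
  \<comment> \<open>The contribution of the other parity in \<open>L2_norm_refl_sum\<close> is
    dropped.\<close>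
  have "(L2_norm unit_ival (refl_sum s f))\<^sup>2 \<le> 2 * (L2_norm torus2 f)\<^sup>2" if "f \<in> L2 torus2" for f
    using assms L2_norm_refl_sum[OF that] zero_le_power2[of "L2_norm unit_ival (refl_sum (-1) f)"]
      zero_le_power2[of "L2_norm unit_ival (refl_sum 1 f)"]
    by (elim insertE emptyE; simp only:; linarith)
  then show "\<exists>B. \<forall>f\<in>L2 torus2. refl_sum s f \<in> L2 unit_ival \<and> L2_norm unit_ival (refl_sum s f) \<le> B * L2_norm torus2 f"
    by (auto intro!: exI[of _ "sqrt 2"] refl_sum_L2 sqrt2_bound)
qed

lemma L2_operator_tendsto:
  assumes A: "L2_operator J K A" and f: "\<forall>\<^sub>F s in F. f s \<in> L2 J"
    and lim: "((\<lambda>s. L2_norm J (f s)) \<longlongrightarrow> 0) F"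
  shows "((\<lambda>s. L2_norm K (A (f s))) \<longlongrightarrow> 0) F"
proof -
  obtain B where B: "\<And>f. f \<in> L2 J \<Longrightarrow> L2_norm K (A f) \<le> B * L2_norm J f"
    using A unfolding L2_operator_def by blast
  show ?thesis
  proof (rule tendsto_sandwich[of "\<lambda>_. 0"])
    show "\<forall>\<^sub>F s in F. 0 \<le> L2_norm K (A (f s))" by simp
    show "\<forall>\<^sub>F s in F. L2_norm K (A (f s)) \<le> B * L2_norm J (f s)"
      using f by eventually_elim (rule B)
    show "((\<lambda>s. B * L2_norm J (f s)) \<longlongrightarrow> 0) F" using tendsto_mult_left[OF lim, of B] by simp
  qed simp
qed

lemma L2_continuous_operator:
  assumes A: "L2_operator J K A" and w: "L2_continuous T J w"
  shows "L2_continuous T K (\<lambda>t. A (w t))"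
  unfolding L2_continuous_def
proof (intro ballI conjI)
  fix t assume t: "t \<in> {0..T}"
  show "A (w t) \<in> L2 K" using A w t by (auto simp: L2_operator_def L2_continuous_def)
  have "A (\<lambda>x. 1 * w s x + (-1) * w t x) = (\<lambda>x. 1 * A (w s) x + (-1) * A (w t) x)" for s
    using A unfolding L2_operator_def by blast
  then have eq: "A (\<lambda>x. w s x - w t x) = (\<lambda>x. A (w s) x - A (w t) x)" for s by simp
  have "((\<lambda>s. L2_norm K (A (\<lambda>x. w s x - w t x))) \<longlongrightarrow> 0) (at t within {0..T})"
  proof (rule L2_operator_tendsto[OF A])
    show "\<forall>\<^sub>F s in at t within {0..T}. (\<lambda>x. w s x - w t x) \<in> L2 J"
      using w t by (auto simp: eventually_at_filter L2_continuous_def intro!: L2_diff always_eventually)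
    show "((\<lambda>s. L2_norm J (\<lambda>x. w s x - w t x)) \<longlongrightarrow> 0) (at t within {0..T})"
      using w t by (auto simp: L2_continuous_def)
  qed
  then show "((\<lambda>s. L2_norm K (\<lambda>x. A (w s) x - A (w t) x)) \<longlongrightarrow> 0) (at t within {0..T})"
    by (simp add: eq)
qed

lemma L2_has_time_deriv_operator:
  assumes A: "L2_operator J K A" and u: "L2_has_time_deriv T J u w"
    and L: "\<And>t. t \<in> {0..T} \<Longrightarrow> u t \<in> L2 J" "\<And>t. t \<in> {0..T} \<Longrightarrow> w t \<in> L2 J"
  shows "L2_has_time_deriv T K (\<lambda>t. A (u t)) (\<lambda>t. A (w t))"
  unfolding L2_has_time_deriv_def
proof (intro ballI)
  fix t assume t: "t \<in> {0..T}"
  let ?q = "\<lambda>s x. (u s x - u t x) / (s - t) - w t x"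
  have lin: "A (\<lambda>x. c * f x + d * g x) = (\<lambda>x. c * A f x + d * A g x)" for c d f g
    using A unfolding L2_operator_def by blast
  \<comment> \<open>Valid for \<open>s = t\<close> as well, where the quotient is 0 on both sides by
    convention.\<close>
  have eq: "A (?q s) = (\<lambda>x. (A (u s) x - A (u t) x) / (s - t) - A (w t) x)" for s
  proof -
    have "A (\<lambda>x. 1 * (1 / (s - t) * u s x + (- 1 / (s - t)) * u t x) + (-1) * w t x)
      = (\<lambda>x. 1 * (1 / (s - t) * A (u s) x + (- 1 / (s - t)) * A (u t) x) + (-1) * A (w t) x)"
      unfolding lin ..
    then show ?thesis by (simp add: diff_divide_distrib)
  qed
  have q: "?q s \<in> L2 J" if "s \<in> {0..T}" for s
    using L2_diff[OF L2_scale[OF L2_diff[OF L(1)[OF that] L(1)[OF t]], of "1 / (s - t)"] L(2)[OF t]] by simp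
  have "((\<lambda>s. L2_norm K (A (?q s))) \<longlongrightarrow> 0) (at t within {0..T})"
  proof (rule L2_operator_tendsto[OF A])
    show "\<forall>\<^sub>F s in at t within {0..T}. ?q s \<in> L2 J"
      using q by (auto simp: eventually_at_filter intro!: always_eventually)
    show "((\<lambda>s. L2_norm J (?q s)) \<longlongrightarrow> 0) (at t within {0..T})"
      using u t by (auto simp: L2_has_time_deriv_def)
  qed
  then show "((\<lambda>s. L2_norm K (\<lambda>x. (A (u s) x - A (u t) x) / (s - t) - A (w t) x)) \<longlongrightarrow> 0) (at t within {0..T})"
    by (simp only: eq)
qed

lemma weak_deriv_cong:
  assumes "\<And>t. t \<in> J \<Longrightarrow> f t = f' t" "\<And>t. t \<in> J \<Longrightarrow> g t = g' t"
  shows "weak_deriv J \<Phi> f g \<longleftrightarrow> weak_deriv J \<Phi> f' g'"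
proof -
  have "L2_inner J f h = L2_inner J f' h" "L2_inner J g h = L2_inner J g' h" for h
    by (rule L2_inner_cong; simp add: assms)+
  then show ?thesis using L2_cong[of J f f'] L2_cong[of J g g'] assms by (simp add: weak_deriv_def)
qed

section \<open>Joint measurability under the reflection of space-time\<close>

definition refl2 :: "real \<times> real \<Rightarrow> real \<times> real" where
  "refl2 p = (fst p, 2 - snd p)"

lemma refl2_refl2 [simp]: "refl2 (refl2 p) = p"
  by (simp add: refl2_def)

lemma
  shows refl2_measurable: "refl2 \<in> lebesgue \<rightarrow>\<^sub>M lebesgue"
    and distr_lebesgue_refl2: "distr lebesgue lebesgue refl2 = lebesgue"
proof -
  \<comment> \<open>The diagonal of the linear part, 1 in time and -1 in space; the product of the
    absolute values is 1, so Lebesgue measure is preserved.\<close>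
  define c :: "real \<times> real \<Rightarrow> real" where "c j = (if j = (1, 0) then 1 else -1)" for j
  have B: "(Basis :: (real \<times> real) set) = {(1, 0), (0, 1)}" by (auto simp: Basis_prod_def)
  have refl2: "refl2 = (\<lambda>p. (0, 2) + (\<Sum>j\<in>Basis. (c j * (p \<bullet> j)) *\<^sub>R j))"
    unfolding B by (auto simp: fun_eq_iff refl2_def c_def)
  have c0: "c j \<noteq> 0" for j by (simp add: c_def)
  show "refl2 \<in> lebesgue \<rightarrow>\<^sub>M lebesgue"
    unfolding refl2 using c0 by (rule lebesgue_affine_measurable)
  have "(\<Prod>j\<in>Basis. \<bar>c j\<bar>) = 1" by (rule prod.neutral) (simp add: c_def)
  then have "lebesgue = density (distr lebesgue lebesgue refl2) (\<lambda>_. 1)"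
    using lebesgue_affine_euclidean[of c "(0, 2)"] c0 by (simp add: refl2)
  then show "distr lebesgue lebesgue refl2 = lebesgue" by (simp add: density_1)
qed

lemma refl_sum_joint_measurable:
  fixes T :: real
  assumes "(\<lambda>(t, x). v t x) \<in> borel_measurable (lebesgue_on ({0..T} \<times> torus2))"
  shows "(\<lambda>(t, x). refl_sum s (v t) x) \<in> borel_measurable (lebesgue_on ({0..T} \<times> unit_ival))"
proof -
  \<comment> \<open>Extension by zero to the plane, where the composition with \<open>refl2\<close>
    is measurable.\<close>
  define W where "W p = indicator ({0..T} \<times> torus2) p * v (fst p) (snd p)" for p
  have sets: "{0..T} \<times> torus2 \<in> sets lebesgue" "{0..T} \<times> unit_ival \<in> sets lebesgue"
    by (auto intro!: sets_completionI_sets borel_Times)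
  have W: "W \<in> borel_measurable lebesgue"
    unfolding W_def using assms sets
    by (simp add: borel_measurable_restrict_space_iff case_prod_beta')
  have "(\<lambda>p. indicator ({0..T} \<times> unit_ival) p * (W p + s * W (refl2 p))) \<in> borel_measurable lebesgue"
    by (intro borel_measurable_times borel_measurable_add borel_measurable_const W
        measurable_compose[OF refl2_measurable W] borel_measurable_indicator sets)
  moreover have "(\<lambda>p. indicator ({0..T} \<times> unit_ival) p * (W p + s * W (refl2 p)))
      = (\<lambda>p. indicator ({0..T} \<times> unit_ival) p * (case p of (t, x) \<Rightarrow> refl_sum s (v t) x))"
    by (auto simp: fun_eq_iff W_def refl2_def refl_sum_def indicator_def)
  ultimately show ?thesis using sets by (simp add: borel_measurable_restrict_space_iff)
qed

lemma refl_ext_joint_measurable: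
  fixes T :: real
  assumes "(\<lambda>(t, x). u t x) \<in> borel_measurable (lebesgue_on ({0..T} \<times> unit_ival))"
  shows "(\<lambda>(t, x). refl_ext s (u t) x) \<in> borel_measurable (lebesgue_on ({0..T} \<times> torus2))"
proof -
  define W where "W p = indicator ({0..T} \<times> unit_ival) p * u (fst p) (snd p)" for p
  have sets: "{0..T} \<times> torus2 \<in> sets lebesgue" "{0..T} \<times> unit_ival \<in> sets lebesgue"
    by (auto intro!: sets_completionI_sets borel_Times)
  have W: "W \<in> borel_measurable lebesgue"
    unfolding W_def using assms sets
    by (simp add: borel_measurable_restrict_space_iff case_prod_beta')
  have "(\<lambda>p. W p + s * W (refl2 p)) \<in> borel_measurable lebesgue"
    by (intro borel_measurable_times borel_measurable_add borel_measurable_const W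
        measurable_compose[OF refl2_measurable W])
  \<comment> \<open>The two summands live over \<open>(0, 1)\<close> and \<open>(1, 2)\<close>, so
    at most one of them is nonzero.\<close>
  moreover have "(\<lambda>p. W p + s * W (refl2 p))
      = (\<lambda>p. indicator ({0..T} \<times> torus2) p * (case p of (t, x) \<Rightarrow> refl_ext s (u t) x))"
    by (auto simp: fun_eq_iff W_def refl2_def refl_ext_def indicator_def)
  ultimately show ?thesis using sets by (simp add: borel_measurable_restrict_space_iff)
qed

lemma weak_wave_sol_L2:
  assumes "weak_wave_sol T J V u ux ut" "t \<in> {0..T}"
  shows "u t \<in> L2 J" "ux t \<in> L2 J" "ut t \<in> L2 J"
  using assms by (auto simp: weak_wave_sol_def L2_continuous_def)

text \<open>\<open>ext\<close> places the extended solution in the torus space, while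
  \<open>sum\<close> turns torus test functions into elements of \<open>V\<close>; adjointness then
  identifies the pairings at each time. Keeping \<open>V\<close> abstract covers both boundary
  conditions.\<close>

lemma weak_wave_sol_refl_ext:
  assumes sol: "weak_wave_sol T unit_ival V u ux ut" and s: "s \<in> {1, -1}"
    and ext: "\<And>f f'. (f, f') \<in> V \<Longrightarrow> (refl_ext s f, refl_ext (- s) f') \<in> H1_torus"
    and sum: "\<And>\<psi> \<psi>'. (\<psi>, \<psi>') \<in> H1_torus \<Longrightarrow> (refl_sum s \<psi>, refl_sum (- s) \<psi>') \<in> V"
  shows "weak_wave_sol T torus2 H1_torus
    (\<lambda>t. refl_ext s (u t)) (\<lambda>t. refl_ext (- s) (ux t)) (\<lambda>t. refl_ext s (ut t))"
proof -
  note L = weak_wave_sol_L2[OF sol]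
  have op: "L2_operator unit_ival torus2 (refl_ext s)" "L2_operator unit_ival torus2 (refl_ext (- s))"
    using s by (auto intro!: L2_operator_refl_ext)
  have weak: "weak_deriv {0<..<T} (C1c {0<..<T})
      (\<lambda>t. L2_inner torus2 (refl_ext s (ut t)) \<psi>) (\<lambda>t. - L2_inner torus2 (refl_ext (- s) (ux t)) \<psi>')"
    if \<psi>: "(\<psi>, \<psi>') \<in> H1_torus" for \<psi> \<psi>'
  proof -
    have \<psi>L: "\<psi> \<in> L2 torus2" "\<psi>' \<in> L2 torus2" using \<psi> by (auto simp: H1_torus_def weak_deriv_def)
    have "weak_deriv {0<..<T} (C1c {0<..<T})
      (\<lambda>t. L2_inner unit_ival (ut t) (refl_sum s \<psi>)) (\<lambda>t. - L2_inner unit_ival (ux t) (refl_sum (- s) \<psi>'))"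
      using sol sum[OF \<psi>] unfolding weak_wave_sol_def by blast
    then show ?thesis
    proof (rule weak_deriv_cong[THEN iffD2, rotated 2])
      fix t assume t: "t \<in> {0<..<T}"
      show "L2_inner torus2 (refl_ext s (ut t)) \<psi> = L2_inner unit_ival (ut t) (refl_sum s \<psi>)"
        and "- L2_inner torus2 (refl_ext (- s) (ux t)) \<psi>' = - L2_inner unit_ival (ux t) (refl_sum (- s) \<psi>')"
        using L[of t] t \<psi>L by (simp_all add: L2_inner_refl_ext)
    qed
  qed
  note S = sol[unfolded weak_wave_sol_def]
  show ?thesis
    unfolding weak_wave_sol_def
  proof (intro conjI)
    show "\<forall>t\<in>{0..T}. (refl_ext s (u t), refl_ext (- s) (ux t)) \<in> H1_torus"
      using S ext by blast
    show "L2_continuous T torus2 (\<lambda>t. refl_ext s (u t))"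
      using S by (intro L2_continuous_operator[OF op(1)]) blast
    show "L2_continuous T torus2 (\<lambda>t. refl_ext (- s) (ux t))"
      using S by (intro L2_continuous_operator[OF op(2)]) blast
    show "L2_continuous T torus2 (\<lambda>t. refl_ext s (ut t))"
      using S by (intro L2_continuous_operator[OF op(1)]) blast
    show "L2_has_time_deriv T torus2 (\<lambda>t. refl_ext s (u t)) (\<lambda>t. refl_ext s (ut t))"
      using S L by (intro L2_has_time_deriv_operator[OF op(1)]) blast+
    show "(\<lambda>(t, x). refl_ext s (ut t) x) \<in> borel_measurable (lebesgue_on ({0..T} \<times> torus2))"
      using S by (intro refl_ext_joint_measurable) blast
    show "\<forall>(\<psi>, \<psi>')\<in>H1_torus. weak_deriv {0<..<T} (C1c {0<..<T})
      (\<lambda>t. L2_inner torus2 (refl_ext s (ut t)) \<psi>) (\<lambda>t. - L2_inner torus2 (refl_ext (- s) (ux t)) \<psi>')"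
      using weak by blast
  qed
qed

text \<open>The roles are exchanged: \<open>sum\<close> places the folded solution in
  \<open>V\<close>, and \<open>ext\<close> makes torus test functions out of elements of
  \<open>V\<close>.\<close>

lemma weak_wave_sol_refl_sum:
  assumes sol: "weak_wave_sol T torus2 H1_torus v vx vt" and s: "s \<in> {1, -1}"
    and ext: "\<And>f f'. (f, f') \<in> V \<Longrightarrow> (refl_ext s f, refl_ext (- s) f') \<in> H1_torus"
    and sum: "\<And>\<psi> \<psi>'. (\<psi>, \<psi>') \<in> H1_torus \<Longrightarrow> (refl_sum s \<psi>, refl_sum (- s) \<psi>') \<in> V"
    and V: "\<And>f f'. (f, f') \<in> V \<Longrightarrow> f \<in> L2 unit_ival \<and> f' \<in> L2 unit_ival"
  shows "weak_wave_sol T unit_ival V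
    (\<lambda>t. refl_sum s (v t)) (\<lambda>t. refl_sum (- s) (vx t)) (\<lambda>t. refl_sum s (vt t))"
proof -
  note L = weak_wave_sol_L2[OF sol]
  have op: "L2_operator torus2 unit_ival (refl_sum s)" "L2_operator torus2 unit_ival (refl_sum (- s))"
    using s by (auto intro!: L2_operator_refl_sum)
  have weak: "weak_deriv {0<..<T} (C1c {0<..<T})
      (\<lambda>t. L2_inner unit_ival (refl_sum s (vt t)) \<psi>) (\<lambda>t. - L2_inner unit_ival (refl_sum (- s) (vx t)) \<psi>')"
    if \<psi>: "(\<psi>, \<psi>') \<in> V" for \<psi> \<psi>'
  proof -
    have "weak_deriv {0<..<T} (C1c {0<..<T})
      (\<lambda>t. L2_inner torus2 (vt t) (refl_ext s \<psi>)) (\<lambda>t. - L2_inner torus2 (vx t) (refl_ext (- s) \<psi>'))"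
      using sol ext[OF \<psi>] unfolding weak_wave_sol_def by blast
    then show ?thesis
    proof (rule weak_deriv_cong[THEN iffD2, rotated 2])
      fix t assume t: "t \<in> {0<..<T}"
      show "L2_inner unit_ival (refl_sum s (vt t)) \<psi> = L2_inner torus2 (vt t) (refl_ext s \<psi>)"
        and "- L2_inner unit_ival (refl_sum (- s) (vx t)) \<psi>' = - L2_inner torus2 (vx t) (refl_ext (- s) \<psi>')"
        using L[of t] t V[OF \<psi>] L2_inner_refl_ext[of \<psi> "vt t" s] L2_inner_refl_ext[of \<psi>' "vx t" "- s"]
        by (simp_all add: L2_inner_commute[of torus2 "vt t"] L2_inner_commute[of torus2 "vx t"]
            L2_inner_commute[of unit_ival _ \<psi>] L2_inner_commute[of unit_ival _ \<psi>'])
    qed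
  qed
  note S = sol[unfolded weak_wave_sol_def]
  show ?thesis
    unfolding weak_wave_sol_def
  proof (intro conjI)
    show "\<forall>t\<in>{0..T}. (refl_sum s (v t), refl_sum (- s) (vx t)) \<in> V"
      using S sum by blast
    show "L2_continuous T unit_ival (\<lambda>t. refl_sum s (v t))"
      using S by (intro L2_continuous_operator[OF op(1)]) blast
    show "L2_continuous T unit_ival (\<lambda>t. refl_sum (- s) (vx t))"
      using S by (intro L2_continuous_operator[OF op(2)]) blast
    show "L2_continuous T unit_ival (\<lambda>t. refl_sum s (vt t))"
      using S by (intro L2_continuous_operator[OF op(1)]) blast
    show "L2_has_time_deriv T unit_ival (\<lambda>t. refl_sum s (v t)) (\<lambda>t. refl_sum s (vt t))"
      using S L by (intro L2_has_time_deriv_operator[OF op(1)]) blast+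
    show "(\<lambda>(t, x). refl_sum s (vt t) x) \<in> borel_measurable (lebesgue_on ({0..T} \<times> unit_ival))"
      using S by (intro refl_sum_joint_measurable) blast
    show "\<forall>(\<psi>, \<psi>')\<in>V. weak_deriv {0<..<T} (C1c {0<..<T})
      (\<lambda>t. L2_inner unit_ival (refl_sum s (vt t)) \<psi>) (\<lambda>t. - L2_inner unit_ival (refl_sum (- s) (vx t)) \<psi>')"
      using weak by blast
  qed
qed

text \<open>\<open>G\<close> lies over the open interval, so \<open>G_ref T G\<close> is the
  disjoint union of \<open>G\<close> and its mirror image. The integral over the mirror image is
  carried back to \<open>G\<close> by \<open>refl2\<close>.\<close>

lemma nn_integral_G_ref:
  assumes G: "G \<subseteq> {0..T} \<times> unit_ival" "G \<in> sets lebesgue"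
    and v: "(\<lambda>(t, x). v t x) \<in> borel_measurable (lebesgue_on ({0..T} \<times> torus2))"
  shows "(\<integral>\<^sup>+(t, x)\<in>G_ref T G. ennreal (\<bar>v t x\<bar>\<^sup>2) \<partial>lebesgue)
    = (\<integral>\<^sup>+(t, x)\<in>G. ennreal (\<bar>v t x\<bar>\<^sup>2 + \<bar>v t (2 - x)\<bar>\<^sup>2) \<partial>lebesgue)"
proof -
  \<comment> \<open>The square is extended by zero off the strip to be measurable on the plane;
    \<open>G_ref T G\<close> lies inside the strip.\<close>
  define F where "F p = ennreal ((indicator ({0..T} \<times> torus2) p * v (fst p) (snd p))\<^sup>2)" for p
  have sets: "{0..T} \<times> torus2 \<in> sets lebesgue"
    by (auto intro!: sets_completionI_sets borel_Times)
  have "(\<lambda>p. indicator ({0..T} \<times> torus2) p * v (fst p) (snd p)) \<in> borel_measurable lebesgue"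
    using v sets by (simp add: borel_measurable_restrict_space_iff case_prod_beta')
  then have F: "F \<in> borel_measurable lebesgue"
    unfolding F_def by (intro measurable_compose[OF _ measurable_ennreal] borel_measurable_power)
  note FR = measurable_compose[OF refl2_measurable F]
  have ind: "indicator G \<in> borel_measurable lebesgue"
    using G(2) by simp
  have "(\<integral>\<^sup>+(t, x)\<in>G_ref T G. ennreal (\<bar>v t x\<bar>\<^sup>2) \<partial>lebesgue)
    = (\<integral>\<^sup>+p. F p * indicator G p + F p * indicator G (refl2 p) \<partial>lebesgue)"
  proof (rule nn_integral_cong)
    fix p :: "real \<times> real"
    obtain t x where p: "p = (t, x)" by (cases p)
    have "fold2 x = (if x \<le> 1 then x else 2 - x)" if "x \<in> torus2"
      using that by (simp add: fold2_def)
    then have "indicator (G_ref T G) p = (indicator G p + indicator G (refl2 p) :: ennreal)"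
      using G(1) by (auto simp: p G_ref_def refl2_def indicator_def)
    moreover have "F p = ennreal (\<bar>v t x\<bar>\<^sup>2)" if "p \<in> G_ref T G"
      using that by (auto simp: p F_def G_ref_def)
    ultimately show "(case p of (t, x) \<Rightarrow> ennreal (\<bar>v t x\<bar>\<^sup>2)) * indicator (G_ref T G) p
        = F p * indicator G p + F p * indicator G (refl2 p)"
      by (cases "p \<in> G_ref T G") (auto simp: p simp flip: distrib_left)
  qed
  also have "\<dots> = (\<integral>\<^sup>+p. F p * indicator G p \<partial>lebesgue) + (\<integral>\<^sup>+p. F p * indicator G (refl2 p) \<partial>lebesgue)"
    by (intro nn_integral_add borel_measurable_times_ennreal F ind measurable_compose[OF refl2_measurable ind])
  also have "(\<integral>\<^sup>+p. F p * indicator G (refl2 p) \<partial>lebesgue)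
      = (\<integral>\<^sup>+p. F (refl2 p) * indicator G p \<partial>distr lebesgue lebesgue refl2)"
    by (subst nn_integral_distr[OF refl2_measurable])
      (auto intro!: borel_measurable_times_ennreal FR ind)
  also have "\<dots> = (\<integral>\<^sup>+p. F (refl2 p) * indicator G p \<partial>lebesgue)"
    by (simp add: distr_lebesgue_refl2)
  also have "(\<integral>\<^sup>+p. F p * indicator G p \<partial>lebesgue) + (\<integral>\<^sup>+p. F (refl2 p) * indicator G p \<partial>lebesgue)
     = (\<integral>\<^sup>+p. F p * indicator G p + F (refl2 p) * indicator G p \<partial>lebesgue)"
    by (intro nn_integral_add[symmetric] borel_measurable_times_ennreal F FR ind)
  also have "\<dots> = (\<integral>\<^sup>+(t, x)\<in>G. ennreal (\<bar>v t x\<bar>\<^sup>2 + \<bar>v t (2 - x)\<bar>\<^sup>2) \<partial>lebesgue)"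
    by (rule nn_integral_cong)
      (use G(1) in \<open>auto simp: F_def refl2_def indicator_def subset_eq\<close>)
  finally show ?thesis .
qed

section \<open>Observability\<close>

lemma H1_L2: "(f, f') \<in> H1 \<Longrightarrow> f \<in> L2 unit_ival \<and> f' \<in> L2 unit_ival"
  by (simp add: H1_def weak_deriv_def)

lemma H10_L2: "(f, f') \<in> H10 \<Longrightarrow> f \<in> L2 unit_ival \<and> f' \<in> L2 unit_ival"
  unfolding H10_def using H1_L2 by blast

lemma measurable_power2_on_indicator:
  fixes T :: real
  assumes G: "G \<subseteq> {0..T} \<times> unit_ival" "G \<in> sets lebesgue"
    and w: "(\<lambda>(t, x). w t x) \<in> borel_measurable (lebesgue_on ({0..T} \<times> unit_ival))"
  shows "(\<lambda>p. (case p of (t, x) \<Rightarrow> ennreal (\<bar>w t x\<bar>\<^sup>2)) * indicator G p) \<in> borel_measurable lebesgue"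
proof -
  have sets: "{0..T} \<times> unit_ival \<in> sets lebesgue"
    by (auto intro!: sets_completionI_sets borel_Times)
  have "(\<lambda>p. indicator ({0..T} \<times> unit_ival) p * w (fst p) (snd p)) \<in> borel_measurable lebesgue"
    using w sets by (simp add: borel_measurable_restrict_space_iff case_prod_beta')
  then have "(\<lambda>p. ennreal ((indicator ({0..T} \<times> unit_ival) p * w (fst p) (snd p))\<^sup>2) * indicator G p)
      \<in> borel_measurable lebesgue"
    by (intro borel_measurable_times_ennreal measurable_compose[OF _ measurable_ennreal]
        borel_measurable_power borel_measurable_indicator G(2))
  also have "(\<lambda>p. ennreal ((indicator ({0..T} \<times> unit_ival) p * w (fst p) (snd p))\<^sup>2) * indicator G p)
      = (\<lambda>p. (case p of (t, x) \<Rightarrow> ennreal (\<bar>w t x\<bar>\<^sup>2)) * indicator G p)"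
    using G(1) by (auto simp: fun_eq_iff indicator_def subset_eq)
  finally show ?thesis .
qed

text \<open>Under extension the energy and the observed integral both double. The doubled energy is
  bounded below by the energy itself, which avoids cancelling in \<open>ennreal\<close> and gives
  the constant \<open>2 * C\<close>.\<close>

lemma observable_if_OBS_T:
  assumes T: "T > 0" and G: "G \<subseteq> {0..T} \<times> unit_ival" "G \<in> sets lebesgue"
    and obs: "OBS_T T (G_ref T G)" and s: "s \<in> {1, -1}"
    and ext: "\<And>f f'. (f, f') \<in> V \<Longrightarrow> (refl_ext s f, refl_ext (- s) f') \<in> H1_torus"
    and sum: "\<And>\<psi> \<psi>'. (\<psi>, \<psi>') \<in> H1_torus \<Longrightarrow> (refl_sum s \<psi>, refl_sum (- s) \<psi>') \<in> V"
  shows "observable T unit_ival V G"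
proof -
  obtain C where C: "C > 0" and obsC: "\<And>v vx vt. weak_wave_sol T torus2 H1_torus v vx vt \<Longrightarrow>
      ennreal ((L2_norm torus2 (vx 0))\<^sup>2 + (L2_norm torus2 (vt 0))\<^sup>2)
       \<le> ennreal C * (\<integral>\<^sup>+(t, x)\<in>G_ref T G. ennreal (\<bar>vt t x\<bar>\<^sup>2) \<partial>lebesgue)"
    using obs unfolding OBS_T_def observable_def by blast
  have "ennreal ((L2_norm unit_ival (ux 0))\<^sup>2 + (L2_norm unit_ival (ut 0))\<^sup>2)
       \<le> ennreal (2 * C) * (\<integral>\<^sup>+(t, x)\<in>G. ennreal (\<bar>ut t x\<bar>\<^sup>2) \<partial>lebesgue)" (is "ennreal ?E \<le> _ * ?Q")
    if sol: "weak_wave_sol T unit_ival V u ux ut" for u ux ut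
  proof -
    let ?vt = "\<lambda>t. refl_ext s (ut t)"
    have s1: "\<bar>s\<bar> = 1" "\<bar>- s\<bar> = 1" "s\<^sup>2 = 1" using s by auto
    have ut: "(\<lambda>(t, x). ut t x) \<in> borel_measurable (lebesgue_on ({0..T} \<times> unit_ival))"
      using sol by (simp add: weak_wave_sol_def)
    note L = weak_wave_sol_L2[OF sol, of 0]
    have "ennreal ?E \<le> ennreal (2 * ?E)" by (intro ennreal_leI) simp
    also have "2 * ?E = (L2_norm torus2 (refl_ext (- s) (ux 0)))\<^sup>2 + (L2_norm torus2 (?vt 0))\<^sup>2"
      using L T s1 by (simp add: L2_norm_refl_ext)
    also have "ennreal \<dots> \<le> ennreal C * (\<integral>\<^sup>+(t, x)\<in>G_ref T G. ennreal (\<bar>?vt t x\<bar>\<^sup>2) \<partial>lebesgue)"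
      by (rule obsC[OF weak_wave_sol_refl_ext[OF sol s ext sum]])
    also have "(\<integral>\<^sup>+(t, x)\<in>G_ref T G. ennreal (\<bar>?vt t x\<bar>\<^sup>2) \<partial>lebesgue)
        = (\<integral>\<^sup>+(t, x)\<in>G. ennreal (\<bar>?vt t x\<bar>\<^sup>2 + \<bar>?vt t (2 - x)\<bar>\<^sup>2) \<partial>lebesgue)"
      by (rule nn_integral_G_ref[OF G refl_ext_joint_measurable[OF ut]])
    also have "\<dots> = (\<integral>\<^sup>+p. 2 * ((case p of (t, x) \<Rightarrow> ennreal (\<bar>ut t x\<bar>\<^sup>2)) * indicator G p) \<partial>lebesgue)"
    proof (rule nn_integral_cong)
      fix p :: "real \<times> real"
      obtain t x where p: "p = (t, x)" by (cases p)
      have "\<bar>?vt t x\<bar>\<^sup>2 + \<bar>?vt t (2 - x)\<bar>\<^sup>2 = 2 * \<bar>ut t x\<bar>\<^sup>2" if "(t, x) \<in> G"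
        using that G(1) s1 by (auto simp: refl_ext_def power_mult_distrib)
      then have "ennreal (\<bar>?vt t x\<bar>\<^sup>2 + \<bar>?vt t (2 - x)\<bar>\<^sup>2) = 2 * ennreal (\<bar>ut t x\<bar>\<^sup>2)" if "(t, x) \<in> G"
        using that by (simp only: ennreal_mult' ennreal_numeral zero_le_numeral)
      then show "(case p of (t, x) \<Rightarrow> ennreal (\<bar>?vt t x\<bar>\<^sup>2 + \<bar>?vt t (2 - x)\<bar>\<^sup>2)) * indicator G p
          = 2 * ((case p of (t, x) \<Rightarrow> ennreal (\<bar>ut t x\<bar>\<^sup>2)) * indicator G p)"
        by (cases "p \<in> G") (simp_all only: p case_prod_conv indicator_simps not_False_eq_True mult_1_right mult_zero_right)
    qed
    also have "\<dots> = 2 * ?Q"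
      by (rule nn_integral_cmult[OF measurable_power2_on_indicator[OF G ut]])
    finally show ?thesis using C by (simp add: ennreal_mult' mult_ac)
  qed
  then show ?thesis using C unfolding observable_def by (intro exI[of _ "2 * C"]) auto
qed

text \<open>The two interval inequalities are added under the common constant
  \<open>C\<^sub>D + C\<^sub>N\<close>, so that the observed integrals of the two parities can be
  recombined into one over the torus.\<close>

lemma OBS_T_if_observable:
  assumes T: "T > 0" and G: "G \<subseteq> {0..T} \<times> unit_ival" "G \<in> sets lebesgue"
    and D: "OBS_D T G" and N: "OBS_N T G"
  shows "OBS_T T (G_ref T G)"
proof -
  obtain C\<^sub>D where CD: "C\<^sub>D > 0" and obsD: "\<And>u ux ut. weak_wave_sol T unit_ival H10 u ux ut \<Longrightarrow>
      ennreal ((L2_norm unit_ival (ux 0))\<^sup>2 + (L2_norm unit_ival (ut 0))\<^sup>2)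
       \<le> ennreal C\<^sub>D * (\<integral>\<^sup>+(t, x)\<in>G. ennreal (\<bar>ut t x\<bar>\<^sup>2) \<partial>lebesgue)"
    using D unfolding OBS_D_def observable_def by blast
  obtain C\<^sub>N where CN: "C\<^sub>N > 0" and obsN: "\<And>u ux ut. weak_wave_sol T unit_ival H1 u ux ut \<Longrightarrow>
      ennreal ((L2_norm unit_ival (ux 0))\<^sup>2 + (L2_norm unit_ival (ut 0))\<^sup>2)
       \<le> ennreal C\<^sub>N * (\<integral>\<^sup>+(t, x)\<in>G. ennreal (\<bar>ut t x\<bar>\<^sup>2) \<partial>lebesgue)"
    using N unfolding OBS_N_def observable_def by blast
  have "ennreal ((L2_norm torus2 (vx 0))\<^sup>2 + (L2_norm torus2 (vt 0))\<^sup>2)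
       \<le> ennreal (2 * (C\<^sub>D + C\<^sub>N)) * (\<integral>\<^sup>+(t, x)\<in>G_ref T G. ennreal (\<bar>vt t x\<bar>\<^sup>2) \<partial>lebesgue)"
      (is "ennreal ?E \<le> _ * ?Q")
    if sol: "weak_wave_sol T torus2 H1_torus v vx vt" for v vx vt
  proof -
    have vt: "(\<lambda>(t, x). vt t x) \<in> borel_measurable (lebesgue_on ({0..T} \<times> torus2))"
      using sol by (simp add: weak_wave_sol_def)
    note L = weak_wave_sol_L2[OF sol, of 0]
    let ?e = "\<lambda>s. (L2_norm unit_ival (refl_sum (- s) (vx 0)))\<^sup>2 + (L2_norm unit_ival (refl_sum s (vt 0)))\<^sup>2"
    let ?q = "\<lambda>s. (\<integral>\<^sup>+(t, x)\<in>G. ennreal (\<bar>refl_sum s (vt t) x\<bar>\<^sup>2) \<partial>lebesgue)"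
    \<comment> \<open>The odd fold is the Dirichlet component; the sign \<open>- (-1)\<close> stays
      unsimplified to match the \<open>- s\<close> of the rule.\<close>
    have "weak_wave_sol T unit_ival H10
      (\<lambda>t. refl_sum (-1) (v t)) (\<lambda>t. refl_sum (- (-1)) (vx t)) (\<lambda>t. refl_sum (-1) (vt t))"
      by (rule weak_wave_sol_refl_sum[OF sol])
        (simp_all add: refl_ext_H10 refl_sum_H10 H10_L2)
    then have eD: "ennreal (?e (-1)) \<le> ennreal C\<^sub>D * ?q (-1)" by (rule obsD)
    have "weak_wave_sol T unit_ival H1
      (\<lambda>t. refl_sum 1 (v t)) (\<lambda>t. refl_sum (- 1) (vx t)) (\<lambda>t. refl_sum 1 (vt t))"
      by (rule weak_wave_sol_refl_sum[OF sol])
        (simp_all add: refl_ext_H1 refl_sum_H1 H1_L2)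
    then have eN: "ennreal (?e 1) \<le> ennreal C\<^sub>N * ?q 1" by (rule obsN)
    note q_meas = measurable_power2_on_indicator[OF G refl_sum_joint_measurable[OF vt]]
    \<comment> \<open>The parallelogram identity for both initial data: the mixed terms of the
      parities cancel in the energy.\<close>
    have "2 * ?E = ?e (-1) + ?e 1"
      using L2_norm_refl_sum[of "vx 0"] L2_norm_refl_sum[of "vt 0"] L T by simp
    moreover have "?E \<le> 2 * ?E" by simp
    ultimately have "ennreal ?E \<le> ennreal (?e (-1) + ?e 1)" by (intro ennreal_leI) linarith
    also have "\<dots> = ennreal (?e (-1)) + ennreal (?e 1)" by (intro ennreal_plus) auto
    also have "\<dots> \<le> ennreal C\<^sub>D * ?q (-1) + ennreal C\<^sub>N * ?q 1" using eD eN by (rule add_mono)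
    also have "\<dots> \<le> ennreal (C\<^sub>D + C\<^sub>N) * ?q (-1) + ennreal (C\<^sub>D + C\<^sub>N) * ?q 1"
      using CD CN by (intro add_mono mult_right_mono ennreal_leI) auto
    also have "\<dots> = ennreal (C\<^sub>D + C\<^sub>N) * (?q (-1) + ?q 1)" by (simp only: distrib_left)
    also have "?q (-1) + ?q 1 = 2 * ?Q"
    proof -
      let ?f = "\<lambda>s p. (case p of (t, x) \<Rightarrow> ennreal (\<bar>refl_sum s (vt t) x\<bar>\<^sup>2)) * indicator G p"
      have "?Q = (\<integral>\<^sup>+(t, x)\<in>G. ennreal (\<bar>vt t x\<bar>\<^sup>2 + \<bar>vt t (2 - x)\<bar>\<^sup>2) \<partial>lebesgue)"
        by (rule nn_integral_G_ref[OF G vt])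
      also have "\<dots> = (\<integral>\<^sup>+p. ennreal (1 / 2) * (?f (-1) p + ?f 1 p) \<partial>lebesgue)"
      proof (rule nn_integral_cong)
        fix p :: "real \<times> real"
        obtain t x where p: "p = (t, x)" by (cases p)
        \<comment> \<open>The same identity at each point. The cross terms do not cancel for either
          parity alone, which is why both observability inequalities enter.\<close>
        have "\<bar>vt t x\<bar>\<^sup>2 + \<bar>vt t (2 - x)\<bar>\<^sup>2
            = 1 / 2 * (\<bar>refl_sum (-1) (vt t) x\<bar>\<^sup>2 + \<bar>refl_sum 1 (vt t) x\<bar>\<^sup>2)"
          by (simp add: refl_sum_def power2_sum power2_diff)
        then have "ennreal (\<bar>vt t x\<bar>\<^sup>2 + \<bar>vt t (2 - x)\<bar>\<^sup>2)
            = ennreal (1 / 2) * (ennreal (\<bar>refl_sum (-1) (vt t) x\<bar>\<^sup>2) + ennreal (\<bar>refl_sum 1 (vt t) x\<bar>\<^sup>2))"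
          by (simp only: ennreal_mult' ennreal_plus zero_le_power2 zero_le_divide_1_iff zero_le_numeral)
        then show "(case p of (t, x) \<Rightarrow> ennreal (\<bar>vt t x\<bar>\<^sup>2 + \<bar>vt t (2 - x)\<bar>\<^sup>2)) * indicator G p
            = ennreal (1 / 2) * (?f (-1) p + ?f 1 p)"
          by (cases "p \<in> G") (simp_all only: p case_prod_conv indicator_simps not_False_eq_True mult_1_right mult_zero_right add_0)
      qed
      also have "\<dots> = ennreal (1 / 2) * (?q (-1) + ?q 1)"
        by (simp only: nn_integral_cmult nn_integral_add q_meas borel_measurable_add)
      finally have "2 * ?Q = ennreal (2 * (1 / 2)) * (?q (-1) + ?q 1)"
        by (simp only: ennreal_mult' mult.assoc ennreal_numeral zero_le_numeral)
      then show ?thesis by simp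
    qed
    also have "ennreal (C\<^sub>D + C\<^sub>N) * (2 * ?Q) = ennreal (2 * (C\<^sub>D + C\<^sub>N)) * ?Q"
      by (simp only: ennreal_mult' ennreal_numeral zero_le_numeral) (simp only: mult_ac)
    finally show ?thesis .
  qed
  then show ?thesis using CD CN unfolding OBS_T_def observable_def
    by (intro exI[of _ "2 * (C\<^sub>D + C\<^sub>N)"]) auto
qed

lemma OBS_D_if_OBS_T:
  assumes "T > 0" "G \<subseteq> {0..T} \<times> unit_ival" "G \<in> sets lebesgue" "OBS_T T (G_ref T G)"
  shows "OBS_D T G"
  unfolding OBS_D_def
  by (rule observable_if_OBS_T[OF assms, of "-1"]) (simp_all add: refl_ext_H10 refl_sum_H10)

lemma OBS_N_if_OBS_T:
  assumes "T > 0" "G \<subseteq> {0..T} \<times> unit_ival" "G \<in> sets lebesgue" "OBS_T T (G_ref T G)"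
  shows "OBS_N T G"
  unfolding OBS_N_def
  by (rule observable_if_OBS_T[OF assms, of 1]) (simp_all add: refl_ext_H1 refl_sum_H1)

theorem corollary4p5:
  fixes T :: real and G :: "(real \<times> real) set"
  assumes "T > 0"
    and "G \<subseteq> {0..T} \<times> {0<..<1}"
    and "G \<in> sets lebesgue"
  shows "(GCC_interval T G \<longleftrightarrow> GCC_torus T (G_ref T G)) \<and>
         (OBS_T T (G_ref T G) \<longleftrightarrow> (OBS_D T G \<and> OBS_N T G))"
  using GCC_interval_iff_torus OBS_D_if_OBS_T[OF assms] OBS_N_if_OBS_T[OF assms]
    OBS_T_if_observable[OF assms]
  by blast

end
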